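(* Let $Q$ be a smooth $n$-dimensional manifold, let $L\in C^\infty(TQ)$ be a regular Lagrangian with Lagrangian vector field $\Gamma_L$, and let $X\colon Q\to TQ$ be a vector field on $Q$. Then $X$ is a solution of the generalized Lagrangian Hamilton--Jacobi problem if, and only if, the submanifold $\mathrm{Im}\,X\subset TQ$ is invariant by $\Gamma_L$ (that is, $\Gamma_L$ is tangent to the submanifold $X(Q)$).
   Context: $\tau_Q\colon TQ\to Q$ has natural coordinates $(q^i,v^i)$. For $L\in C^\infty(TQ)$: $\theta_L=\frac{\partial L}{\partial v^i}dq^i$, $\omega_L=-d\theta_L$, $E_L=\Delta(L)-L$ with $\Delta=v^i\frac{\partial}{\partial v^i}$ the Liouville vector field. $L$ is regular if $\omega_L$ is symplectic; then $\Gamma_L$ is the unique vector field on $TQ$ with $i(\Gamma_L)\omega_L=dE_L$ (it is a second order differential equation field: $T\tau_Q\circ\Gamma_L=\mathrm{Id}_{TQ}$). A vector field on $Q$ is regarded as a section $X\colon Q\to TQ$ of $\tau_Q$. $X$ is a solution of the generalized Lagrangian Hamilton--Jacobi problem if for every integral curve $\gamma$ of $X$ (a curve in $Q$ on an open interval with $\dot\gamma=X\circ\gamma$), the curve $\dot\gamma=X\circ\gamma$ in $TQ$ is an integral curve of $\Gamma_L$. *)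

theory Defs
  imports "HOL-Analysis.Analysis"
begin

section \<open>Smooth maps between open subsets of Euclidean spaces\<close>

text \<open>For a finite-dimensional domain and an open set \<open>S\<close>, \<open>C_k_on k S f\<close> says that \<open>f\<close> is
  \<open>k\<close> times continuously differentiable on \<open>S\<close>. All uses below are of this kind.\<close>

primrec C_k_on :: "nat \<Rightarrow> 'b::real_normed_vector set \<Rightarrow> ('b \<Rightarrow> 'c::real_normed_vector) \<Rightarrow> bool" where
  "C_k_on 0 S f = continuous_on S f"
| "C_k_on (Suc k) S f =
     ((\<forall>x\<in>S. f differentiable (at x)) \<and> (\<forall>h. C_k_on k S (\<lambda>x. frechet_derivative f (at x) h)))"

definition smooth_on :: "'b::real_normed_vector set \<Rightarrow> ('b \<Rightarrow> 'c::real_normed_vector) \<Rightarrow> bool" where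
  "smooth_on S f \<longleftrightarrow> (\<forall>k. C_k_on k S f)"


section \<open>Smooth manifolds\<close>

text \<open>A manifold is presented by a smooth atlas: its points are the points covered by the charts,
  and its topology is the one that makes every chart a homeomorphism onto an open subset of the
  model space \<open>'e\<close>; the dimension is \<open>DIM('e)\<close>. A chart is a domain together with a coordinate map,
  whose values outside the domain are irrelevant. The atlas need not be maximal.\<close>

type_synonym ('a, 'e) chart = "'a set \<times> ('a \<Rightarrow> 'e)"

abbreviation domain :: "('a, 'e) chart \<Rightarrow> 'a set" where
  "domain c \<equiv> fst c"

abbreviation coord :: "('a, 'e) chart \<Rightarrow> 'a \<Rightarrow> 'e" where
  "coord c \<equiv> snd c"

definition param :: "('a, 'e) chart \<Rightarrow> 'e \<Rightarrow> 'a" where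
  "param c = inv_into (domain c) (coord c)"

definition transition :: "('a, 'e) chart \<Rightarrow> ('a, 'e) chart \<Rightarrow> 'e \<Rightarrow> 'e" where
  "transition c d = coord d \<circ> param c"

definition carrier :: "('a, 'e) chart set \<Rightarrow> 'a set" where
  "carrier A = (\<Union>c\<in>A. domain c)"

definition smooth_atlas :: "('a, 'e::euclidean_space) chart set \<Rightarrow> bool" where
  "smooth_atlas A \<longleftrightarrow>
     (\<forall>c\<in>A. inj_on (coord c) (domain c) \<and> open (coord c ` domain c)) \<and>
     (\<forall>c\<in>A. \<forall>d\<in>A. open (coord c ` (domain c \<inter> domain d)) \<and>
                 smooth_on (coord c ` (domain c \<inter> domain d)) (transition c d))"

definition atlas_topology :: "('a, 'e::euclidean_space) chart set \<Rightarrow> 'a topology" where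
  "atlas_topology A =
     topology (\<lambda>U. U \<subseteq> carrier A \<and> (\<forall>c\<in>A. open {x \<in> coord c ` domain c. param c x \<in> U}))"

lemma openin_atlas_topology:
  "openin (atlas_topology A) U \<longleftrightarrow>
     U \<subseteq> carrier A \<and> (\<forall>c\<in>A. open {x \<in> coord c ` domain c. param c x \<in> U})"
proof -
  have "istopology (\<lambda>U. U \<subseteq> carrier A \<and> (\<forall>c\<in>A. open {x \<in> coord c ` domain c. param c x \<in> U}))"
    unfolding istopology_def
  proof (intro conjI allI impI ballI)
    fix S T c
    assume S: "S \<subseteq> carrier A \<and> (\<forall>c\<in>A. open {x \<in> coord c ` domain c. param c x \<in> S})"
      and T: "T \<subseteq> carrier A \<and> (\<forall>c\<in>A. open {x \<in> coord c ` domain c. param c x \<in> T})"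
    show "S \<inter> T \<subseteq> carrier A" using S by blast
    assume "c \<in> A"
    then have "open ({x \<in> coord c ` domain c. param c x \<in> S} \<inter> {x \<in> coord c ` domain c. param c x \<in> T})"
      using S T by (intro open_Int) auto
    moreover have "{x \<in> coord c ` domain c. param c x \<in> S \<inter> T} =
      {x \<in> coord c ` domain c. param c x \<in> S} \<inter> {x \<in> coord c ` domain c. param c x \<in> T}" by auto
    ultimately show "open {x \<in> coord c ` domain c. param c x \<in> S \<inter> T}" by (simp only:)
  next
    fix K c
    assume K: "\<forall>S\<in>K. S \<subseteq> carrier A \<and> (\<forall>c\<in>A. open {x \<in> coord c ` domain c. param c x \<in> S})"
    show "\<Union>K \<subseteq> carrier A" using K by blast
    assume "c \<in> A"
    then have "open (\<Union>S\<in>K. {x \<in> coord c ` domain c. param c x \<in> S})"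
      using K by (intro open_UN) auto
    moreover have "{x \<in> coord c ` domain c. param c x \<in> \<Union>K} =
      (\<Union>S\<in>K. {x \<in> coord c ` domain c. param c x \<in> S})" by auto
    ultimately show "open {x \<in> coord c ` domain c. param c x \<in> \<Union>K}" by (simp only:)
  qed
  then show ?thesis by (simp add: atlas_topology_def topology_inverse')
qed

definition smooth_manifold :: "('a, 'e::euclidean_space) chart set \<Rightarrow> bool" where
  "smooth_manifold A \<longleftrightarrow>
     smooth_atlas A \<and> Hausdorff_space (atlas_topology A) \<and> second_countable (atlas_topology A)"

text \<open>Openness of the sets on which the local expressions are defined expresses continuity.\<close>

definition smooth_map ::
  "('a, 'e::euclidean_space) chart set \<Rightarrow> ('b, 'f::euclidean_space) chart set \<Rightarrow> ('a \<Rightarrow> 'b) \<Rightarrow> bool" where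
  "smooth_map A B f \<longleftrightarrow> f ` carrier A \<subseteq> carrier B \<and>
     (\<forall>c\<in>A. \<forall>d\<in>B. open (coord c ` (domain c \<inter> f -` domain d)) \<and>
                 smooth_on (coord c ` (domain c \<inter> f -` domain d)) (coord d \<circ> f \<circ> param c))"

definition smooth_function :: "('a, 'e::euclidean_space) chart set \<Rightarrow> ('a \<Rightarrow> real) \<Rightarrow> bool" where
  "smooth_function A f \<longleftrightarrow> (\<forall>c\<in>A. smooth_on (coord c ` domain c) (f \<circ> param c))"


section \<open>Tangent bundle and vector fields\<close>

text \<open>A tangent vector at \<open>p\<close> assigns to each chart around \<open>p\<close> its components in that chart,
  subject to the usual transformation law; it is set to \<open>0\<close> at all other charts, so that equal
  tangent vectors are equal as functions. An element of the tangent bundle is a point together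
  with a tangent vector at that point.\<close>

type_synonym ('a, 'e) tangent = "('a, 'e) chart \<Rightarrow> 'e"
type_synonym ('a, 'e) tvec = "'a \<times> ('a, 'e) tangent"

definition tangent_space ::
  "('a, 'e::euclidean_space) chart set \<Rightarrow> 'a \<Rightarrow> ('a, 'e) tangent set" where
  "tangent_space A p =
     {v. (\<forall>c. \<not> (c \<in> A \<and> p \<in> domain c) \<longrightarrow> v c = 0) \<and>
         (\<forall>c\<in>A. \<forall>d\<in>A. p \<in> domain c \<longrightarrow> p \<in> domain d \<longrightarrow>
            v d = frechet_derivative (transition c d) (at (coord c p)) (v c))}"

definition tangent_bundle :: "('a, 'e::euclidean_space) chart set \<Rightarrow> ('a, 'e) tvec set" where
  "tangent_bundle A = {(p, v). p \<in> carrier A \<and> v \<in> tangent_space A p}"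

text \<open>The natural chart \<open>(q, v)\<close> of the tangent bundle induced by a chart \<open>q\<close> of the base.\<close>

definition tangent_chart ::
  "('a, 'e::euclidean_space) chart set \<Rightarrow> ('a, 'e) chart \<Rightarrow> (('a, 'e) tvec, 'e \<times> 'e) chart" where
  "tangent_chart A c =
     ({u \<in> tangent_bundle A. fst u \<in> domain c}, \<lambda>u. (coord c (fst u), snd u c))"

definition tangent_atlas ::
  "('a, 'e::euclidean_space) chart set \<Rightarrow> (('a, 'e) tvec, 'e \<times> 'e) chart set" where
  "tangent_atlas A = tangent_chart A ` A"

definition vector_field ::
  "('a, 'e::euclidean_space) chart set \<Rightarrow> ('a \<Rightarrow> ('a, 'e) tvec) \<Rightarrow> bool" where
  "vector_field A Y \<longleftrightarrow>
     smooth_map A (tangent_atlas A) Y \<and> (\<forall>p\<in>carrier A. fst (Y p) = p)"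

text \<open>The tangent vector at \<open>p\<close> with components \<open>h\<close> in the chart \<open>c\<close>, for \<open>c\<close> in \<open>A\<close> around \<open>p\<close>.\<close>

definition tangent_of ::
  "('a, 'e::euclidean_space) chart set \<Rightarrow> ('a, 'e) chart \<Rightarrow> 'a \<Rightarrow> 'e \<Rightarrow> ('a, 'e) tangent" where
  "tangent_of A c p h = (\<lambda>d. if d \<in> A \<and> p \<in> domain d
     then frechet_derivative (transition c d) (at (coord c p)) h else 0)"

text \<open>Coordinate formulas below are evaluated in an arbitrarily chosen chart around the point;
  each of them is independent of the choice.\<close>

definition chart_at :: "('a, 'e) chart set \<Rightarrow> 'a \<Rightarrow> ('a, 'e) chart" where
  "chart_at A p = (SOME c. c \<in> A \<and> p \<in> domain c)"


section \<open>Differential forms\<close>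

definition differential ::
  "('a, 'e::euclidean_space) chart set \<Rightarrow> ('a \<Rightarrow> real) \<Rightarrow> 'a \<Rightarrow> ('a, 'e) tangent \<Rightarrow> real" where
  "differential A f p \<xi> =
     (let c = chart_at A p in frechet_derivative (f \<circ> param c) (at (coord c p)) (\<xi> c))"

text \<open>The exterior derivative of 1-forms and 2-forms, with the convention
  \<open>d\<theta>(X,Y) = X(\<theta>(Y)) - Y(\<theta>(X)) - \<theta>([X,Y])\<close>, evaluated on the vector fields that have constant
  components in the chosen chart (and therefore commute).\<close>

definition ext_deriv_1form ::
  "('a, 'e::euclidean_space) chart set \<Rightarrow> ('a \<Rightarrow> ('a, 'e) tangent \<Rightarrow> real) \<Rightarrow>
     'a \<Rightarrow> ('a, 'e) tangent \<Rightarrow> ('a, 'e) tangent \<Rightarrow> real" where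
  "ext_deriv_1form A \<theta> p \<xi> \<eta> =
     (let c = chart_at A p;
          comp = (\<lambda>h x. \<theta> (param c x) (tangent_of A c (param c x) h));
          D = (\<lambda>g h. frechet_derivative g (at (coord c p)) h)
      in D (comp (\<eta> c)) (\<xi> c) - D (comp (\<xi> c)) (\<eta> c))"

definition ext_deriv_2form ::
  "('a, 'e::euclidean_space) chart set \<Rightarrow> ('a \<Rightarrow> ('a, 'e) tangent \<Rightarrow> ('a, 'e) tangent \<Rightarrow> real) \<Rightarrow>
     'a \<Rightarrow> ('a, 'e) tangent \<Rightarrow> ('a, 'e) tangent \<Rightarrow> ('a, 'e) tangent \<Rightarrow> real" where
  "ext_deriv_2form A \<omega> p \<xi> \<eta> \<zeta> =
     (let c = chart_at A p;
          comp = (\<lambda>h k x. \<omega> (param c x) (tangent_of A c (param c x) h) (tangent_of A c (param c x) k));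
          D = (\<lambda>g h. frechet_derivative g (at (coord c p)) h)
      in D (comp (\<eta> c) (\<zeta> c)) (\<xi> c) - D (comp (\<xi> c) (\<zeta> c)) (\<eta> c) + D (comp (\<xi> c) (\<eta> c)) (\<zeta> c))"

definition smooth_2form ::
  "('a, 'e::euclidean_space) chart set \<Rightarrow>
     ('a \<Rightarrow> ('a, 'e) tangent \<Rightarrow> ('a, 'e) tangent \<Rightarrow> real) \<Rightarrow> bool" where
  "smooth_2form A \<omega> \<longleftrightarrow>
     (\<forall>p\<in>carrier A. \<forall>\<xi>\<in>tangent_space A p. \<omega> p \<xi> \<xi> = 0) \<and>
     (\<forall>c\<in>A. \<forall>p\<in>domain c. bilinear (\<lambda>h k. \<omega> p (tangent_of A c p h) (tangent_of A c p k))) \<and>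
     (\<forall>c\<in>A. \<forall>h k. smooth_on (coord c ` domain c)
        (\<lambda>x. \<omega> (param c x) (tangent_of A c (param c x) h) (tangent_of A c (param c x) k)))"

definition symplectic ::
  "('a, 'e::euclidean_space) chart set \<Rightarrow>
     ('a \<Rightarrow> ('a, 'e) tangent \<Rightarrow> ('a, 'e) tangent \<Rightarrow> real) \<Rightarrow> bool" where
  "symplectic A \<omega> \<longleftrightarrow> smooth_2form A \<omega> \<and>
     (\<forall>p\<in>carrier A. \<forall>\<xi>\<in>tangent_space A p. \<forall>\<eta>\<in>tangent_space A p. \<forall>\<zeta>\<in>tangent_space A p.
        ext_deriv_2form A \<omega> p \<xi> \<eta> \<zeta> = 0) \<and>
     (\<forall>p\<in>carrier A. \<forall>\<xi>\<in>tangent_space A p.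
        (\<forall>\<eta>\<in>tangent_space A p. \<omega> p \<xi> \<eta> = 0) \<longrightarrow> \<xi> = (\<lambda>_. 0))"


section \<open>Lagrangian mechanics\<close>

text \<open>\<open>\<theta>\<^sub>L = (\<partial>L/\<partial>v\<^sup>i) dq\<^sup>i\<close> in natural coordinates: the index \<open>i\<close> is a basis vector \<open>b\<close>, and
  \<open>\<partial>/\<partial>v\<^sup>i\<close> is differentiation in the direction \<open>(0, b)\<close>.\<close>

definition theta ::
  "('a, 'e::euclidean_space) chart set \<Rightarrow> (('a, 'e) tvec \<Rightarrow> real) \<Rightarrow>
     ('a, 'e) tvec \<Rightarrow> (('a, 'e) tvec, 'e \<times> 'e) tangent \<Rightarrow> real" where
  "theta Q L u \<xi> =
     (let C = tangent_chart Q (chart_at Q (fst u))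
      in \<Sum>b\<in>Basis. frechet_derivative (L \<circ> param C) (at (coord C u)) (0, b) * (fst (\<xi> C) \<bullet> b))"

definition omega ::
  "('a, 'e::euclidean_space) chart set \<Rightarrow> (('a, 'e) tvec \<Rightarrow> real) \<Rightarrow>
     ('a, 'e) tvec \<Rightarrow> (('a, 'e) tvec, 'e \<times> 'e) tangent \<Rightarrow> (('a, 'e) tvec, 'e \<times> 'e) tangent \<Rightarrow> real" where
  "omega Q L u \<xi> \<eta> = - ext_deriv_1form (tangent_atlas Q) (theta Q L) u \<xi> \<eta>"

text \<open>The Liouville vector field \<open>v\<^sup>i \<partial>/\<partial>v\<^sup>i\<close>, with components \<open>(0, v)\<close> in natural coordinates.\<close>

definition liouville ::
  "('a, 'e::euclidean_space) chart set \<Rightarrow> ('a, 'e) tvec \<Rightarrow> (('a, 'e) tvec, 'e \<times> 'e) tvec" where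
  "liouville Q u =
     (let c = chart_at Q (fst u)
      in (u, tangent_of (tangent_atlas Q) (tangent_chart Q c) u (0, snd u c)))"

definition energy ::
  "('a, 'e::euclidean_space) chart set \<Rightarrow> (('a, 'e) tvec \<Rightarrow> real) \<Rightarrow> ('a, 'e) tvec \<Rightarrow> real" where
  "energy Q L u = differential (tangent_atlas Q) L u (snd (liouville Q u)) - L u"

definition regular_lagrangian ::
  "('a, 'e::euclidean_space) chart set \<Rightarrow> (('a, 'e) tvec \<Rightarrow> real) \<Rightarrow> bool" where
  "regular_lagrangian Q L \<longleftrightarrow> symplectic (tangent_atlas Q) (omega Q L)"

definition lagrangian_vector_field ::
  "('a, 'e::euclidean_space) chart set \<Rightarrow> (('a, 'e) tvec \<Rightarrow> real) \<Rightarrow>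
     (('a, 'e) tvec \<Rightarrow> (('a, 'e) tvec, 'e \<times> 'e) tvec) \<Rightarrow> bool" where
  "lagrangian_vector_field Q L \<Gamma> \<longleftrightarrow>
     vector_field (tangent_atlas Q) \<Gamma> \<and>
     (\<forall>u\<in>tangent_bundle Q. \<forall>\<eta>\<in>tangent_space (tangent_atlas Q) u.
        omega Q L u (snd (\<Gamma> u)) \<eta> = differential (tangent_atlas Q) (energy Q L) u \<eta>)"


section \<open>Curves, the Hamilton--Jacobi problem and invariance\<close>

definition continuous_curve ::
  "('a, 'e::euclidean_space) chart set \<Rightarrow> real set \<Rightarrow> (real \<Rightarrow> 'a) \<Rightarrow> bool" where
  "continuous_curve A I \<gamma> \<longleftrightarrow> open I \<and> is_interval I \<and> \<gamma> ` I \<subseteq> carrier A \<and>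
     (\<forall>c\<in>A. open {t \<in> I. \<gamma> t \<in> domain c} \<and> continuous_on {t \<in> I. \<gamma> t \<in> domain c} (coord c \<circ> \<gamma>))"

definition differentiable_curve ::
  "('a, 'e::euclidean_space) chart set \<Rightarrow> real set \<Rightarrow> (real \<Rightarrow> 'a) \<Rightarrow> bool" where
  "differentiable_curve A I \<gamma> \<longleftrightarrow> continuous_curve A I \<gamma> \<and>
     (\<forall>c\<in>A. \<forall>t\<in>I. \<gamma> t \<in> domain c \<longrightarrow> (coord c \<circ> \<gamma>) differentiable (at t))"

definition smooth_curve ::
  "('a, 'e::euclidean_space) chart set \<Rightarrow> real set \<Rightarrow> (real \<Rightarrow> 'a) \<Rightarrow> bool" where
  "smooth_curve A I \<gamma> \<longleftrightarrow> continuous_curve A I \<gamma> \<and>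
     (\<forall>c\<in>A. smooth_on {t \<in> I. \<gamma> t \<in> domain c} (coord c \<circ> \<gamma>))"

definition velocity ::
  "('a, 'e::euclidean_space) chart set \<Rightarrow> (real \<Rightarrow> 'a) \<Rightarrow> real \<Rightarrow> ('a, 'e) tvec" where
  "velocity A \<gamma> t = (\<gamma> t, \<lambda>c. if c \<in> A \<and> \<gamma> t \<in> domain c
     then vector_derivative (coord c \<circ> \<gamma>) (at t) else 0)"

text \<open>Integral curves of smooth vector fields are automatically smooth, so requiring mere
  differentiability here does not enlarge the class.\<close>

definition integral_curve ::
  "('a, 'e::euclidean_space) chart set \<Rightarrow> ('a \<Rightarrow> ('a, 'e) tvec) \<Rightarrow> real set \<Rightarrow> (real \<Rightarrow> 'a) \<Rightarrow> bool" where
  "integral_curve A Y I \<gamma> \<longleftrightarrow>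
     differentiable_curve A I \<gamma> \<and> (\<forall>t\<in>I. velocity A \<gamma> t = Y (\<gamma> t))"

definition HJ_solution ::
  "('a, 'e::euclidean_space) chart set \<Rightarrow> (('a, 'e) tvec \<Rightarrow> (('a, 'e) tvec, 'e \<times> 'e) tvec) \<Rightarrow>
     ('a \<Rightarrow> ('a, 'e) tvec) \<Rightarrow> bool" where
  "HJ_solution Q \<Gamma> X \<longleftrightarrow>
     (\<forall>I \<gamma>. integral_curve Q X I \<gamma> \<longrightarrow> integral_curve (tangent_atlas Q) \<Gamma> I (X \<circ> \<gamma>))"

text \<open>The tangent space of an embedded submanifold \<open>S\<close> at \<open>p\<close>, as a set of elements of the ambient
  tangent bundle: the velocities at \<open>p\<close> of the smooth curves of the ambient manifold that stay
  in \<open>S\<close>.\<close>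

definition submanifold_tangent_space ::
  "('a, 'e::euclidean_space) chart set \<Rightarrow> 'a set \<Rightarrow> 'a \<Rightarrow> ('a, 'e) tvec set" where
  "submanifold_tangent_space A S p =
     {velocity A \<sigma> 0 | \<sigma> I. smooth_curve A I \<sigma> \<and> 0 \<in> I \<and> \<sigma> 0 = p \<and> \<sigma> ` I \<subseteq> S}"

definition invariant_submanifold ::
  "('a, 'e::euclidean_space) chart set \<Rightarrow> ('a \<Rightarrow> ('a, 'e) tvec) \<Rightarrow> 'a set \<Rightarrow> bool" where
  "invariant_submanifold A Y S \<longleftrightarrow> (\<forall>p\<in>S. Y p \<in> submanifold_tangent_space A S p)"

end

theory Submission
  imports Defs
begin

text \<open>Both conditions are equivalent to \<open>\<Gamma> \<circ> X = TX \<circ> X\<close>. By the chain rule this identity says that \<open>X\<close>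
  maps integral curves of \<open>X\<close> to integral curves of \<open>\<Gamma>\<close>, since through every point of \<open>Q\<close> there is an
  integral curve of \<open>X\<close>. Conversely, if \<open>\<Gamma>\<close> is tangent to the image of \<open>X\<close>, then \<open>\<Gamma> (X p) = TX w\<close> for
  some tangent vector \<open>w\<close> at \<open>p\<close>; as \<open>\<Gamma>\<close> is a second order differential equation, projecting to \<open>Q\<close>
  gives \<open>w = X p\<close>.\<close>

section \<open>Smooth maps\<close>

lemma frechet_derivative_eq:
  "(f has_derivative f') (at x) \<Longrightarrow> frechet_derivative f (at x) = f'"
  by (metis frechet_derivative_at)

lemma frechet_derivative_cong_open:
  assumes "open S" "x \<in> S" "\<And>y. y \<in> S \<Longrightarrow> f y = g y"
  shows "frechet_derivative f (at x) = frechet_derivative g (at x)"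
proof -
  have "(f has_derivative f') (at x) \<longleftrightarrow> (g has_derivative f') (at x)" for f'
    using assms by (metis has_derivative_transform_within_open)
  then show ?thesis
    by (simp add: frechet_derivative_def)
qed

lemma C_k_on_cong:
  assumes "open S" "\<And>x. x \<in> S \<Longrightarrow> f x = g x" "C_k_on k S f"
  shows "C_k_on k S g"
  using assms(2,3)
proof (induction k arbitrary: f g)
  case 0
  then show ?case by (simp cong: continuous_on_cong)
next
  case (Suc k)
  have "g differentiable (at x)" if "x \<in> S" for x
    using that Suc.prems assms(1) unfolding differentiable_def
    by (metis C_k_on.simps(2) differentiable_def has_derivative_transform_within_open)
  moreover have "C_k_on k S (\<lambda>x. frechet_derivative g (at x) h)" for h
  proof (rule Suc.IH)
    show "C_k_on k S (\<lambda>x. frechet_derivative f (at x) h)" using Suc.prems by simp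
    show "frechet_derivative f (at x) h = frechet_derivative g (at x) h" if "x \<in> S" for x
      using frechet_derivative_cong_open[OF assms(1) that Suc.prems(1)] by simp
  qed
  ultimately show ?case by simp
qed

lemma smooth_on_differentiable:
  "smooth_on S f \<Longrightarrow> x \<in> S \<Longrightarrow> f differentiable (at x)"
  unfolding smooth_on_def by (metis C_k_on.simps(2))

lemma smooth_on_has_derivative:
  "smooth_on S f \<Longrightarrow> x \<in> S \<Longrightarrow> (f has_derivative frechet_derivative f (at x)) (at x)"
  using smooth_on_differentiable frechet_derivative_works by blast

lemma smooth_on_frechet_derivative:
  "smooth_on S f \<Longrightarrow> smooth_on S (\<lambda>x. frechet_derivative f (at x) h)"
  unfolding smooth_on_def by (metis C_k_on.simps(2))

lemma smooth_on_continuous_on: "smooth_on S f \<Longrightarrow> continuous_on S f"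
  unfolding smooth_on_def by (metis C_k_on.simps(1))

lemma C_k_on_line:
  fixes x0 v :: "'b::real_normed_vector" and f :: "'b \<Rightarrow> 'c::real_normed_vector"
  assumes T: "open T" "\<And>t. t \<in> T \<Longrightarrow> x0 + t *\<^sub>R v \<in> S"
    and "C_k_on k S f"
  shows "C_k_on k T (\<lambda>t. f (x0 + t *\<^sub>R v))"
  using assms(3)
proof (induction k arbitrary: f)
  case 0
  then have "continuous_on T (f \<circ> (\<lambda>t. x0 + t *\<^sub>R v))"
    by (intro continuous_on_compose continuous_intros) (auto intro: continuous_on_subset simp: T)
  then show ?case by (simp add: o_def)
next
  case (Suc k)
  have der: "((\<lambda>t. f (x0 + t *\<^sub>R v)) has_derivative
      (\<lambda>h. frechet_derivative f (at (x0 + t *\<^sub>R v)) (h *\<^sub>R v))) (at t)" if "t \<in> T" for t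
  proof -
    have "(f has_derivative frechet_derivative f (at (x0 + t *\<^sub>R v))) (at (x0 + t *\<^sub>R v))"
      using Suc.prems T(2)[OF that] frechet_derivative_works by fastforce
    moreover have "((\<lambda>t. x0 + t *\<^sub>R v) has_derivative (\<lambda>h. h *\<^sub>R v)) (at t)"
      by (auto intro!: derivative_eq_intros)
    ultimately show ?thesis using diff_chain_at by (fastforce simp: o_def)
  qed
  moreover have "C_k_on k T (\<lambda>t. frechet_derivative (\<lambda>t. f (x0 + t *\<^sub>R v)) (at t) h)" for h
  proof (rule C_k_on_cong[OF T(1)])
    have "C_k_on k S (\<lambda>x. frechet_derivative f (at x) (h *\<^sub>R v))" using Suc.prems by simp
    from Suc.IH[OF this]
    show "C_k_on k T (\<lambda>t. frechet_derivative f (at (x0 + t *\<^sub>R v)) (h *\<^sub>R v))" .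
  qed (simp add: frechet_derivative_eq[OF der])
  ultimately show ?case by (auto simp: differentiable_def)
qed

lemma smooth_on_line:
  "open T \<Longrightarrow> (\<And>t. t \<in> T \<Longrightarrow> x0 + t *\<^sub>R v \<in> S) \<Longrightarrow> smooth_on S f \<Longrightarrow>
    smooth_on T (\<lambda>t. f (x0 + t *\<^sub>R v))"
  unfolding smooth_on_def by (blast intro: C_k_on_line)

lemma C_k_on_snd:
  assumes "open S" "C_k_on k S f"
  shows "C_k_on k S (\<lambda>x. snd (f x))"
  using assms(2)
proof (induction k arbitrary: f)
  case 0
  then show ?case by (simp add: continuous_on_snd)
next
  case (Suc k)
  have der: "((\<lambda>x. snd (f x)) has_derivative (\<lambda>h. snd (frechet_derivative f (at x) h))) (at x)"
    if "x \<in> S" for x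
    using Suc.prems that frechet_derivative_works by (intro has_derivative_snd) auto
  moreover have "C_k_on k S (\<lambda>x. frechet_derivative (\<lambda>x. snd (f x)) (at x) h)" for h
  proof (rule C_k_on_cong[OF assms(1)])
    show "C_k_on k S (\<lambda>x. snd (frechet_derivative f (at x) h))"
      using Suc.prems by (intro Suc.IH) simp
  qed (simp add: frechet_derivative_eq[OF der])
  ultimately show ?case by (auto simp: differentiable_def)
qed

section \<open>Local existence for ordinary differential equations\<close>

lemma smooth_on_lipschitz_cball:
  fixes f :: "'e::euclidean_space \<Rightarrow> 'c::real_normed_vector"
  assumes "smooth_on S f" "cball x0 r \<subseteq> S"
  obtains K where "K \<ge> 0"
    "\<And>x y. x \<in> cball x0 r \<Longrightarrow> y \<in> cball x0 r \<Longrightarrow> norm (f x - f y) \<le> K * norm (x - y)"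
proof -
  define D where "D = (\<lambda>x h. frechet_derivative f (at x) h)"
  have "\<exists>B. \<forall>x\<in>cball x0 r. norm (D x b) \<le> B" for b
  proof -
    have "continuous_on (cball x0 r) (\<lambda>x. D x b)"
      using assms smooth_on_frechet_derivative smooth_on_continuous_on continuous_on_subset
      unfolding D_def by blast
    then have "bounded ((\<lambda>x. D x b) ` cball x0 r)"
      by (intro compact_imp_bounded compact_continuous_image) auto
    then show ?thesis by (auto simp: bounded_iff)
  qed
  then obtain B where B: "\<And>b x. x \<in> cball x0 r \<Longrightarrow> norm (D x b) \<le> B b" by metis
  define K where "K = (\<Sum>b\<in>Basis. \<bar>B b\<bar>)"
  have der: "(f has_derivative D x) (at x)" if "x \<in> cball x0 r" for x
    using smooth_on_has_derivative[OF assms(1)] assms(2) that unfolding D_def by blast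
  have "onorm (D x) \<le> K" if x: "x \<in> cball x0 r" for x
  proof (rule onorm_bound)
    show "K \<ge> 0" by (simp add: K_def sum_nonneg)
    fix h
    have lin: "linear (D x)" using der[OF x] has_derivative_linear by blast
    have "D x h = D x (\<Sum>b\<in>Basis. (h \<bullet> b) *\<^sub>R b)" by (simp add: euclidean_representation)
    also have "\<dots> = (\<Sum>b\<in>Basis. (h \<bullet> b) *\<^sub>R D x b)"
      by (simp add: linear_sum[OF lin] linear_cmul[OF lin])
    also have "norm \<dots> \<le> (\<Sum>b\<in>Basis. norm h * \<bar>B b\<bar>)"
    proof (rule sum_norm_le)
      fix b :: 'e assume "b \<in> Basis"
      have "norm (D x b) \<le> \<bar>B b\<bar>" using B[OF x, of b] by linarith
      then show "norm ((h \<bullet> b) *\<^sub>R D x b) \<le> norm h * \<bar>B b\<bar>"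
        using Basis_le_norm[OF \<open>b \<in> Basis\<close>, of h] by (simp add: mult_mono)
    qed
    finally show "norm (D x h) \<le> K * norm h"
      by (simp add: K_def sum_distrib_left mult.commute)
  qed
  then have "norm (f x - f y) \<le> K * norm (x - y)"
    if "x \<in> cball x0 r" "y \<in> cball x0 r" for x y
    using that der by (intro differentiable_bound[of "cball x0 r" f D]) (auto intro: has_derivative_at_withinI)
  moreover have "K \<ge> 0" by (simp add: K_def sum_nonneg)
  ultimately show thesis using that by blast
qed

text \<open>Picard--Lindelof for a globally Lipschitz field: on \<open>{-e..e}\<close> with \<open>3 * K * e \<le> 1/2\<close>, the integral
  operator, extended to the line by freezing its values outside \<open>{-e..e}\<close>, is a contraction.\<close>

lemma lipschitz_ode_solution:
  fixes g :: "'e::euclidean_space \<Rightarrow> 'e"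
  assumes K: "K \<ge> 0" "\<And>x y. norm (g x - g y) \<le> K * norm (x - y)"
  obtains e x where "e > 0" "x 0 = x0"
    "\<And>t. t \<in> {-e<..<e} \<Longrightarrow> (x has_vector_derivative g (x t)) (at t)"
proof -
  define e where "e = 1 / (6 * (K + 1))"
  have e: "e > 0" "3 * K * e \<le> 1/2" using K(1) by (auto simp: e_def field_simps)
  define cl where "cl = (\<lambda>t. max (- e) (min e t))"
  have cl: "cl t \<in> {-e..e}" "\<And>t. t \<in> {-e..e} \<Longrightarrow> cl t = t" for t using e by (auto simp: cl_def)
  have cont_g: "continuous_on UNIV g"
  proof (rule lipschitz_on_continuous_on)
    show "K-lipschitz_on UNIV g"
      using K by (auto simp: lipschitz_on_def dist_norm)
  qed
  have cont_gx: "continuous_on A (\<lambda>s. g (apply_bcontfun x s))" for A and x :: "real \<Rightarrow>\<^sub>C 'e"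
    using continuous_on_compose2[OF cont_g, of A "apply_bcontfun x"] by (simp add: continuous_on_apply_bcontfun)
  have int_gx: "(\<lambda>s. g (apply_bcontfun x s)) integrable_on {a..b}" for a b and x :: "real \<Rightarrow>\<^sub>C 'e"
    by (rule integrable_continuous_real[OF cont_gx])
  define F where "F = (\<lambda>(x :: real \<Rightarrow>\<^sub>C 'e) t.
    integral {-e..t} (\<lambda>s. g (apply_bcontfun x s)) - integral {-e..0} (\<lambda>s. g (apply_bcontfun x s)))"
  have F_cont: "continuous_on {-e..e} (F x)" for x
    unfolding F_def by (intro continuous_intros indefinite_integral_continuous_1 int_gx)
  have P_bcont: "(\<lambda>t. x0 + F x (cl t)) \<in> bcontfun" for x
  proof -
    have "continuous_on UNIV (\<lambda>t. F x (cl t))"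
      by (rule continuous_on_compose2[OF F_cont])
        (use cl in \<open>auto simp: cl_def intro!: continuous_intros\<close>)
    moreover have "bounded (F x ` {-e..e})"
      by (intro compact_imp_bounded compact_continuous_image F_cont) auto
    then obtain B where "\<And>t. t \<in> {-e..e} \<Longrightarrow> norm (F x t) \<le> B"
      unfolding bounded_iff by (metis imageI)
    then have "norm (x0 + F x (cl t)) \<le> norm x0 + B" for t
      using cl(1)[of t] by (meson add_left_mono norm_triangle_le)
    ultimately show ?thesis
      by (intro bcontfun_normI continuous_intros) auto
  qed
  define P where "P = (\<lambda>x. Bcontfun (\<lambda>t. x0 + F x (cl t)))"
  have P: "apply_bcontfun (P x) t = x0 + F x (cl t)" for x t
    unfolding P_def using P_bcont by (simp add: Bcontfun_inverse)
  have "dist (P x) (P y) \<le> 1/2 * dist x y" for x y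
  proof (rule dist_bound)
    fix t
    let ?d = "\<lambda>s. g (apply_bcontfun x s) - g (apply_bcontfun y s)"
    have est: "norm (integral {-e..s} ?d) \<le> K * dist x y * (s + e)" if "s \<in> {-e..e}" for s
    proof -
      have "norm (integral {-e..s} ?d) \<le> (K * dist x y) * (s - (-e))"
      proof (rule integral_bound)
        show "- e \<le> s" using that by simp
        show "continuous_on {- e..s} ?d" by (intro continuous_intros cont_gx)
        fix r
        have "norm (?d r) \<le> K * dist (apply_bcontfun x r) (apply_bcontfun y r)"
          using K(2) by (simp add: dist_norm)
        also have "\<dots> \<le> K * dist x y" by (intro mult_left_mono dist_bounded K)
        finally show "norm (?d r) \<le> K * dist x y" .
      qed
      then show ?thesis by simp
    qed
    have "P x t - P y t = integral {-e..cl t} ?d - integral {-e..0} ?d"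
      by (simp add: P F_def integral_diff[OF int_gx int_gx])
    also have "norm \<dots> \<le> K * dist x y * (cl t + e) + K * dist x y * (0 + e)"
      using est[of "cl t"] est[of 0] cl(1)[of t] e(1)
      by (intro order_trans[OF norm_triangle_ineq4] add_mono) auto
    also have "\<dots> = K * dist x y * (cl t + 2 * e)" by (simp add: algebra_simps)
    also have "\<dots> \<le> K * dist x y * (3 * e)"
      using cl(1)[of t] K(1) by (intro mult_left_mono) auto
    also have "\<dots> = (3 * K * e) * dist x y" by simp
    also have "\<dots> \<le> 1/2 * dist x y" using e by (intro mult_right_mono) auto
    finally show "dist (P x t) (P y t) \<le> 1/2 * dist x y" by (simp add: dist_norm)
  qed
  then have "\<exists>!x. P x = x" using banach_fix_type[of "1/2" P] by simp
  then obtain x where x: "P x = x" by blast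
  have x_eq: "apply_bcontfun x t = x0 + F x t" if "t \<in> {-e..e}" for t
    using P[of x t] x cl(2)[OF that] by simp
  show thesis
  proof (rule that[OF e(1)])
    show "apply_bcontfun x 0 = x0" using x_eq[of 0] e by (simp add: F_def)
    fix t assume t: "t \<in> {-e<..<e}"
    have "((\<lambda>t. integral {-e..t} (\<lambda>s. g (apply_bcontfun x s))) has_vector_derivative g (apply_bcontfun x t))
        (at t within {-e..e})"
      using t by (intro integral_has_vector_derivative cont_gx) auto
    then have "((\<lambda>t. integral {-e..t} (\<lambda>s. g (apply_bcontfun x s))) has_vector_derivative g (apply_bcontfun x t)) (at t)"
      using t at_within_interior[of t "{-e..e}"] by (simp add: interior_atLeastAtMost_real)
    then have "((\<lambda>t. x0 + F x t) has_vector_derivative g (apply_bcontfun x t)) (at t)"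
      unfolding F_def by (auto intro!: derivative_eq_intros)
    then show "(apply_bcontfun x has_vector_derivative g (apply_bcontfun x t)) (at t)"
      using has_vector_derivative_transform_within_open[of "\<lambda>t. x0 + F x t" _ t "{-e<..<e}"] t x_eq
      by auto
  qed
qed

lemma smooth_ode_solution:
  fixes f :: "'e::euclidean_space \<Rightarrow> 'e"
  assumes "open U" "smooth_on U f" "x0 \<in> U"
  obtains e x where "e > 0" "x 0 = x0"
    "\<And>t. t \<in> {-e<..<e} \<Longrightarrow> x t \<in> U \<and> (x has_vector_derivative f (x t)) (at t)"
proof -
  obtain r where r: "r > 0" "cball x0 r \<subseteq> U" using assms(1,3) open_contains_cball by blast
  obtain K where K: "K \<ge> 0"
    "\<And>x y. x \<in> cball x0 r \<Longrightarrow> y \<in> cball x0 r \<Longrightarrow> norm (f x - f y) \<le> K * norm (x - y)"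
    using smooth_on_lipschitz_cball[OF assms(2) r(2)] by blast
  define c where "c = closest_point (cball x0 r)"
  have c: "c y \<in> cball x0 r" "norm (c y - c z) \<le> norm (y - z)"
      "\<And>y. y \<in> cball x0 r \<Longrightarrow> c y = y" for y z
    using r(1) closest_point_in_set[of "cball x0 r"] closest_point_lipschitz[of "cball x0 r" y z]
    by (auto simp: c_def closest_point_self dist_norm)
  have "norm (f (c y) - f (c z)) \<le> K * norm (y - z)" for y z
    using K(2)[OF c(1) c(1), of y z] c(2)[of y z] K(1) by (meson mult_left_mono order_trans)
  then obtain e x where e: "e > 0" "x 0 = x0"
    and x: "\<And>t. t \<in> {-e<..<e} \<Longrightarrow> (x has_vector_derivative f (c (x t))) (at t)"
    using lipschitz_ode_solution[OF K(1), of "\<lambda>y. f (c y)" x0] by blast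
  have "isCont x 0" using x[of 0] e(1) has_vector_derivative_continuous by auto
  then obtain d where d: "d > 0" "\<And>t. dist t 0 < d \<Longrightarrow> dist (x t) (x 0) < r"
    using r(1) unfolding continuous_at_eps_delta by metis
  show thesis
  proof (rule that[of "min d e" x])
    fix t assume t: "t \<in> {- min d e<..<min d e}"
    then have "dist (x t) x0 < r" using d(2)[of t] e(2) by (auto simp: dist_norm)
    then have "x t \<in> cball x0 r" by (simp add: dist_commute)
    then show "x t \<in> U \<and> (x has_vector_derivative f (x t)) (at t)"
      using x[of t] t r(2) c(3) by auto
  qed (use e d in auto)
qed

section \<open>Charts and tangent vectors\<close>

text \<open>The part of \<open>smooth_atlas\<close> that is needed for the iterated tangent bundle as well.\<close>

definition differentiable_atlas :: "('a, 'e::euclidean_space) chart set \<Rightarrow> bool" where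
  "differentiable_atlas A \<longleftrightarrow>
     (\<forall>c\<in>A. inj_on (coord c) (domain c)) \<and>
     (\<forall>c\<in>A. \<forall>d\<in>A. open (coord c ` (domain c \<inter> domain d)) \<and>
        (\<forall>x\<in>coord c ` (domain c \<inter> domain d). transition c d differentiable (at x)))"

lemma smooth_atlas_imp_differentiable_atlas: "smooth_atlas A \<Longrightarrow> differentiable_atlas A"
  unfolding smooth_atlas_def differentiable_atlas_def by (metis smooth_on_differentiable)

lemma param_coord: "differentiable_atlas A \<Longrightarrow> c \<in> A \<Longrightarrow> p \<in> domain c \<Longrightarrow> param c (coord c p) = p"
  by (simp add: differentiable_atlas_def param_def)

lemma coord_param: "x \<in> coord c ` domain c \<Longrightarrow> coord c (param c x) = x"
  by (simp add: param_def f_inv_into_f)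

lemma param_in_domain: "x \<in> coord c ` domain c \<Longrightarrow> param c x \<in> domain c"
  by (simp add: param_def inv_into_into)

lemma param_in_overlap:
  assumes "differentiable_atlas A" "c \<in> A" "x \<in> coord c ` (domain c \<inter> S)"
  shows "param c x \<in> domain c" "param c x \<in> S" "coord c (param c x) = x"
  using assms param_coord by fastforce+

lemma open_overlap:
  "differentiable_atlas A \<Longrightarrow> c \<in> A \<Longrightarrow> d \<in> A \<Longrightarrow> open (coord c ` (domain c \<inter> domain d))"
  by (simp add: differentiable_atlas_def)

lemma open_coord_domain: "differentiable_atlas A \<Longrightarrow> c \<in> A \<Longrightarrow> open (coord c ` domain c)"
  using open_overlap[of A c c] by simp

lemma transition_has_derivative:
  assumes "differentiable_atlas A" "c \<in> A" "d \<in> A" "p \<in> domain c" "p \<in> domain d"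
  shows "(transition c d has_derivative frechet_derivative (transition c d) (at (coord c p))) (at (coord c p))"
  using assms frechet_derivative_works unfolding differentiable_atlas_def by blast

lemma transition_coord:
  "differentiable_atlas A \<Longrightarrow> c \<in> A \<Longrightarrow> p \<in> domain c \<Longrightarrow> transition c d (coord c p) = coord d p"
  by (simp add: transition_def param_coord)

lemma frechet_derivative_transition_self:
  assumes "differentiable_atlas A" "c \<in> A" "p \<in> domain c"
  shows "frechet_derivative (transition c c) (at (coord c p)) h = h"
proof -
  have "frechet_derivative (transition c c) (at (coord c p)) = frechet_derivative (\<lambda>x. x) (at (coord c p))"
    by (rule frechet_derivative_cong_open[OF open_coord_domain[OF assms(1,2)]])
      (use assms(3) in \<open>auto simp: transition_coord[OF assms(1,2)]\<close>)
  then show ?thesis by simp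
qed

lemma frechet_derivative_change_chart:
  assumes A: "differentiable_atlas A" "c \<in> A" "d \<in> A" "p \<in> domain c" "p \<in> domain d"
    and f: "(f \<circ> param d) differentiable (at (coord d p))"
  shows "frechet_derivative (f \<circ> param c) (at (coord c p)) h =
    frechet_derivative (f \<circ> param d) (at (coord d p)) (frechet_derivative (transition c d) (at (coord c p)) h)"
proof -
  let ?g = "frechet_derivative (f \<circ> param d) (at (coord d p))"
  let ?t = "frechet_derivative (transition c d) (at (coord c p))"
  have "(f \<circ> param d \<circ> transition c d has_derivative ?g \<circ> ?t) (at (coord c p))"
    using diff_chain_at[OF transition_has_derivative[OF A], of "f \<circ> param d" ?g]
      f transition_coord[OF A(1,2,4), of d]
    by (simp add: frechet_derivative_works)
  then have "frechet_derivative (f \<circ> param d \<circ> transition c d) (at (coord c p)) = ?g \<circ> ?t"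
    by (rule frechet_derivative_eq)
  moreover have "frechet_derivative (f \<circ> param c) (at (coord c p)) =
      frechet_derivative (f \<circ> param d \<circ> transition c d) (at (coord c p))"
    by (rule frechet_derivative_cong_open[OF open_overlap[OF A(1,2,3)]])
      (use A in \<open>auto simp: transition_coord[OF A(1,2)] param_coord\<close>)
  ultimately show ?thesis by simp
qed

lemma frechet_derivative_transition_cocycle:
  assumes "differentiable_atlas A" "c \<in> A" "d \<in> A" "e \<in> A"
    "p \<in> domain c" "p \<in> domain d" "p \<in> domain e"
  shows "frechet_derivative (transition d e) (at (coord d p))
      (frechet_derivative (transition c d) (at (coord c p)) h) =
    frechet_derivative (transition c e) (at (coord c p)) h"
proof -
  have "(coord e \<circ> param d) differentiable (at (coord d p))"
    using transition_has_derivative[OF assms(1,3,4,6,7)]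
    unfolding transition_def[symmetric] differentiable_def by blast
  from frechet_derivative_change_chart[OF assms(1,2,3,5,6) this, of h] show ?thesis
    by (simp only: transition_def)
qed

lemma tangent_space_transition:
  assumes "\<xi> \<in> tangent_space A p" "c \<in> A" "d \<in> A" "p \<in> domain c" "p \<in> domain d"
  shows "\<xi> d = frechet_derivative (transition c d) (at (coord c p)) (\<xi> c)"
  using assms unfolding tangent_space_def by blast

lemma tangent_of_eq:
  assumes "\<xi> \<in> tangent_space A p" "c \<in> A" "p \<in> domain c"
  shows "tangent_of A c p (\<xi> c) = \<xi>"
proof
  fix d
  show "tangent_of A c p (\<xi> c) d = \<xi> d"
  proof (cases "d \<in> A \<and> p \<in> domain d")
    case True
    then show ?thesis
      using tangent_space_transition[OF assms(1,2) _ assms(3), of d] by (simp add: tangent_of_def)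
  next
    case False
    then have "\<xi> d = 0" using assms(1) unfolding tangent_space_def by blast
    with False show ?thesis by (auto simp: tangent_of_def)
  qed
qed

lemma tangent_of_in_tangent_space:
  assumes "differentiable_atlas A" "c \<in> A" "p \<in> domain c"
  shows "tangent_of A c p h \<in> tangent_space A p"
  unfolding tangent_space_def
proof (intro CollectI conjI allI ballI impI)
  show "tangent_of A c p h d = 0" if "\<not> (d \<in> A \<and> p \<in> domain d)" for d
    using that by (auto simp: tangent_of_def)
  show "tangent_of A c p h e =
      frechet_derivative (transition d e) (at (coord d p)) (tangent_of A c p h d)"
    if "d \<in> A" "e \<in> A" "p \<in> domain d" "p \<in> domain e" for d e
    using that frechet_derivative_transition_cocycle[OF assms(1,2) that(1,2) assms(3) that(3,4)]
    by (simp add: tangent_of_def)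
qed

lemma tangent_of_self:
  assumes "differentiable_atlas A" "c \<in> A" "p \<in> domain c"
  shows "tangent_of A c p h c = h"
  using assms frechet_derivative_transition_self[OF assms] by (simp add: tangent_of_def)

lemma chart_at:
  assumes "p \<in> carrier A"
  shows "chart_at A p \<in> A" "p \<in> domain (chart_at A p)"
proof -
  have "\<exists>c. c \<in> A \<and> p \<in> domain c" using assms by (auto simp: carrier_def)
  from someI_ex[OF this] show "chart_at A p \<in> A" "p \<in> domain (chart_at A p)"
    by (auto simp: chart_at_def)
qed

lemma differential_in_chart:
  assumes "differentiable_atlas A" "c \<in> A" "p \<in> domain c" "\<xi> \<in> tangent_space A p"
    and "\<And>d. d \<in> A \<Longrightarrow> p \<in> domain d \<Longrightarrow> (f \<circ> param d) differentiable (at (coord d p))"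
  shows "differential A f p \<xi> = frechet_derivative (f \<circ> param c) (at (coord c p)) (\<xi> c)"
proof -
  have "p \<in> carrier A" using assms(2,3) by (auto simp: carrier_def)
  note d = chart_at[OF this]
  show ?thesis
    using frechet_derivative_change_chart[OF assms(1) assms(2) d(1) assms(3) d(2) assms(5)[OF d], of "\<xi> c"]
      tangent_space_transition[OF assms(4) assms(2) d(1) assms(3) d(2)]
    by (simp add: differential_def Let_def)
qed

section \<open>The tangent bundle\<close>

lemma domain_tangent_chart: "domain (tangent_chart A c) = {u \<in> tangent_bundle A. fst u \<in> domain c}"
  by (simp add: tangent_chart_def)

lemma coord_tangent_chart: "coord (tangent_chart A c) u = (coord c (fst u), snd u c)"
  by (simp add: tangent_chart_def)

lemma tangent_chart_in_atlas: "c \<in> A \<Longrightarrow> tangent_chart A c \<in> tangent_atlas A"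
  by (simp add: tangent_atlas_def)

lemma carrier_tangent_atlas: "carrier (tangent_atlas A) = tangent_bundle A"
  unfolding carrier_def tangent_atlas_def
  by (auto simp: domain_tangent_chart tangent_bundle_def carrier_def)

lemma tangent_bundle_tangent_of:
  assumes "differentiable_atlas A" "c \<in> A" "p \<in> domain c"
  shows "(p, tangent_of A c p v) \<in> tangent_bundle A"
  using assms tangent_of_in_tangent_space[OF assms] by (auto simp: tangent_bundle_def carrier_def)

lemma tangent_bundle_eqI:
  assumes "u \<in> tangent_bundle A" "w \<in> tangent_bundle A" "c \<in> A" "fst u \<in> domain c"
    "fst u = fst w" "snd u c = snd w c"
  shows "u = w"
proof (rule prod_eqI[OF assms(5)])
  have "snd u \<in> tangent_space A (fst u)" "snd w \<in> tangent_space A (fst w)"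
    using assms(1,2) by (auto simp: tangent_bundle_def)
  then show "snd u = snd w"
    using tangent_of_eq[OF _ assms(3)] assms(4-6) by metis
qed

lemma inj_on_coord_tangent_chart:
  assumes "differentiable_atlas A" "c \<in> A"
  shows "inj_on (coord (tangent_chart A c)) (domain (tangent_chart A c))"
proof (rule inj_onI)
  fix u w assume uw: "u \<in> domain (tangent_chart A c)" "w \<in> domain (tangent_chart A c)"
    and eq: "coord (tangent_chart A c) u = coord (tangent_chart A c) w"
  have "inj_on (coord c) (domain c)" using assms by (simp add: differentiable_atlas_def)
  then have "fst u = fst w"
    using uw eq by (simp add: domain_tangent_chart coord_tangent_chart inj_on_eq_iff)
  with uw eq show "u = w"
    by (intro tangent_bundle_eqI[OF _ _ assms(2)]) (auto simp: domain_tangent_chart coord_tangent_chart)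
qed

lemma coord_tangent_chart_overlap:
  assumes "differentiable_atlas A" "c \<in> A"
  shows "coord (tangent_chart A c) ` (domain (tangent_chart A c) \<inter> domain (tangent_chart A d)) =
    (coord c ` (domain c \<inter> domain d)) \<times> UNIV" (is "?l = ?r")
proof
  show "?l \<subseteq> ?r" by (auto simp: domain_tangent_chart coord_tangent_chart)
  have "(coord c p, v) \<in> ?l" if "p \<in> domain c" "p \<in> domain d" for p v
  proof (rule image_eqI)
    show "(coord c p, v) = coord (tangent_chart A c) (p, tangent_of A c p v)"
      using tangent_of_self[OF assms] that by (simp add: coord_tangent_chart)
  qed (use tangent_bundle_tangent_of[OF assms] that in \<open>simp add: domain_tangent_chart\<close>)
  then show "?r \<subseteq> ?l" by auto
qed

lemma param_tangent_chart:
  assumes "differentiable_atlas A" "c \<in> A" "p \<in> domain c"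
  shows "param (tangent_chart A c) (coord c p, v) = (p, tangent_of A c p v)"
  using inv_into_f_f[OF inj_on_coord_tangent_chart[OF assms(1,2)], of "(p, tangent_of A c p v)"]
    tangent_bundle_tangent_of[OF assms] tangent_of_self[OF assms] assms(3)
  by (simp add: param_def domain_tangent_chart coord_tangent_chart)

lemma transition_tangent_chart:
  assumes "differentiable_atlas A" "c \<in> A" "d \<in> A" "x \<in> coord c ` (domain c \<inter> domain d)"
  shows "transition (tangent_chart A c) (tangent_chart A d) (x, v) =
    (transition c d x, frechet_derivative (transition c d) (at x) v)"
proof -
  obtain p where "p \<in> domain c" "p \<in> domain d" "x = coord c p" using assms(4) by blast
  then show ?thesis
    using param_tangent_chart[OF assms(1,2)] transition_coord[OF assms(1,2), of p d] assms(3)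
    by (simp add: transition_def[of "tangent_chart A c"] coord_tangent_chart tangent_of_def)
qed

lemma transition_tangent_chart_has_derivative:
  fixes A :: "('a, 'e::euclidean_space) chart set"
  assumes A: "smooth_atlas A" "c \<in> A" "d \<in> A" and x: "x \<in> coord c ` (domain c \<inter> domain d)"
  obtains T where "(transition (tangent_chart A c) (tangent_chart A d) has_derivative T) (at (x, v))"
    "\<And>h k. fst (T (h, k)) = frechet_derivative (transition c d) (at x) h"
    "\<And>k. T (0, k) = (0, frechet_derivative (transition c d) (at x) k)"
proof -
  note diff = smooth_atlas_imp_differentiable_atlas[OF A(1)]
  define S where "S = coord c ` (domain c \<inter> domain d)"
  define \<phi> where "\<phi> = transition c d"
  define D where "D = (\<lambda>x. frechet_derivative \<phi> (at x))"
  have S: "open S" and smooth: "smooth_on S \<phi>"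
    using A by (auto simp: smooth_atlas_def S_def \<phi>_def)
  have \<phi>: "(\<phi> has_derivative D x) (at x)" if "x \<in> S" for x
    using smooth_on_has_derivative[OF smooth that] by (simp add: D_def)
  define D2 where "D2 = (\<lambda>b. frechet_derivative (\<lambda>x. D x b) (at x))"
  have D2: "((\<lambda>x. D x b) has_derivative D2 b) (at x)" for b
    using smooth_on_has_derivative[OF smooth_on_frechet_derivative[OF smooth]] x
    by (simp add: D_def D2_def S_def)
  have D_sum: "D x v = (\<Sum>b\<in>Basis. (v \<bullet> b) *\<^sub>R D x b)" if "x \<in> S" for x v
  proof -
    have lin: "linear (D x)" using \<phi>[OF that] has_derivative_linear by blast
    have "D x v = D x (\<Sum>b\<in>Basis. (v \<bullet> b) *\<^sub>R b)" by (simp add: euclidean_representation)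
    then show ?thesis by (simp add: linear_sum[OF lin] linear_cmul[OF lin])
  qed
  define T where "T = (\<lambda>z. (D x (fst z),
    \<Sum>b\<in>Basis. (v \<bullet> b) *\<^sub>R D2 b (fst z) + (snd z \<bullet> b) *\<^sub>R D x b))"
  have 1: "((\<lambda>z. \<phi> (fst z)) has_derivative (\<lambda>z. D x (fst z))) (at (x, v))"
    using has_derivative_compose[of fst fst "(x, v)" UNIV \<phi> "D x"] \<phi>[of x] x
    by (simp add: S_def has_derivative_fst)
  have 2: "((\<lambda>z. D (fst z) b) has_derivative (\<lambda>z. D2 b (fst z))) (at (x, v))" for b
    using has_derivative_compose[of fst fst "(x, v)" UNIV "\<lambda>x. D x b" "D2 b"] D2[of b]
    by (simp add: has_derivative_fst)
  have "((\<lambda>z. (\<phi> (fst z), \<Sum>b\<in>Basis. (snd z \<bullet> b) *\<^sub>R D (fst z) b)) has_derivative T) (at (x, v))"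
    unfolding T_def by (rule derivative_eq_intros 1 2 refl | simp)+
  then have T: "(transition (tangent_chart A c) (tangent_chart A d) has_derivative T) (at (x, v))"
  proof (rule has_derivative_transform_within_open)
    show "open (S \<times> (UNIV :: 'e set))" using S by (simp add: open_Times)
    show "(\<phi> (fst z), \<Sum>b\<in>Basis. (snd z \<bullet> b) *\<^sub>R D (fst z) b) =
        transition (tangent_chart A c) (tangent_chart A d) z" if "z \<in> S \<times> UNIV" for z
      using that transition_tangent_chart[OF diff A(2,3), of "fst z" "snd z"] D_sum[of "fst z" "snd z"]
      by (auto simp: S_def \<phi>_def D_def)
  qed (use x in \<open>simp add: S_def\<close>)
  show thesis
  proof (rule that[OF T])
    show "fst (T (h, k)) = frechet_derivative (transition c d) (at x) h" for h k
      by (simp add: T_def D_def \<phi>_def)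
    have lin: "linear (D x)" "linear (D2 b)" for b
      using \<phi>[of x] x D2 has_derivative_linear by (auto simp: S_def)
    show "T (0, k) = (0, frechet_derivative (transition c d) (at x) k)" for k
      using D_sum[of x k] x linear_0[OF lin(1)] linear_0[OF lin(2)]
      by (simp add: T_def S_def) (simp add: D_def \<phi>_def)
  qed
qed

lemma differentiable_atlas_tangent_atlas:
  assumes "smooth_atlas A"
  shows "differentiable_atlas (tangent_atlas A)"
  unfolding differentiable_atlas_def
proof (intro conjI ballI)
  note diff = smooth_atlas_imp_differentiable_atlas[OF assms]
  fix C assume "C \<in> tangent_atlas A"
  then obtain c where c: "c \<in> A" "C = tangent_chart A c" by (auto simp: tangent_atlas_def)
  then show "inj_on (coord C) (domain C)" using inj_on_coord_tangent_chart[OF diff] by simp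
  fix D assume "D \<in> tangent_atlas A"
  then obtain d where d: "d \<in> A" "D = tangent_chart A d" by (auto simp: tangent_atlas_def)
  have eq: "coord C ` (domain C \<inter> domain D) = (coord c ` (domain c \<inter> domain d)) \<times> UNIV"
    using coord_tangent_chart_overlap[OF diff] c d by simp
  then show "open (coord C ` (domain C \<inter> domain D))"
    using open_overlap[OF diff c(1) d(1)] by (simp add: open_Times)
  fix z assume z: "z \<in> coord C ` (domain C \<inter> domain D)"
  then have "fst z \<in> coord c ` (domain c \<inter> domain d)" unfolding eq by (auto simp: mem_Times_iff)
  then show "transition C D differentiable (at z)"
    using transition_tangent_chart_has_derivative[OF assms c(1) d(1), of "fst z" "snd z"] c d
    unfolding differentiable_def by (metis prod.collapse)
qed

lemma frechet_derivative_transition_tangent_chart: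
  assumes "smooth_atlas A" "c \<in> A" "d \<in> A" "u \<in> tangent_bundle A" "fst u \<in> domain c" "fst u \<in> domain d"
  defines "T \<equiv> frechet_derivative (transition (tangent_chart A c) (tangent_chart A d)) (at (coord (tangent_chart A c) u))"
    and "D \<equiv> frechet_derivative (transition c d) (at (coord c (fst u)))"
  shows "fst (T h) = D (fst h)" "T (0, k) = (0, D k)"
proof -
  have "coord c (fst u) \<in> coord c ` (domain c \<inter> domain d)" using assms(5,6) by blast
  from transition_tangent_chart_has_derivative[OF assms(1-3) this, of "snd u c"]
  obtain T' where "(transition (tangent_chart A c) (tangent_chart A d) has_derivative T') (at (coord c (fst u), snd u c))"
    "\<And>h k. fst (T' (h, k)) = D h" "\<And>k. T' (0, k) = (0, D k)"
    unfolding D_def by blast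
  moreover from this(1) have "T = T'"
    unfolding T_def coord_tangent_chart by (rule frechet_derivative_eq)
  ultimately show "fst (T h) = D (fst h)" "T (0, k) = (0, D k)"
    by (metis prod.collapse)+
qed

section \<open>Curves\<close>

definition pushforward where
  "pushforward B f c p w = (f p, \<lambda>d. if d \<in> B \<and> f p \<in> domain d
     then frechet_derivative (coord d \<circ> f \<circ> param c) (at (coord c p)) w else 0)"

lemma smooth_map_curve_has_vector_derivative:
  assumes A: "differentiable_atlas A" and f: "smooth_map A B f" and c: "c \<in> A" and d: "d \<in> B"
    and J: "open J" "t \<in> J" "\<gamma> ` J \<subseteq> domain c" "f (\<gamma> t) \<in> domain d"
    and w: "(coord c \<circ> \<gamma> has_vector_derivative w) (at t)"
  shows "(coord d \<circ> (f \<circ> \<gamma>) has_vector_derivative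
    frechet_derivative (coord d \<circ> f \<circ> param c) (at (coord c (\<gamma> t))) w) (at t)"
proof -
  let ?F = "coord d \<circ> f \<circ> param c"
  have "coord c (\<gamma> t) \<in> coord c ` (domain c \<inter> f -` domain d)" using J by auto
  moreover have "smooth_on (coord c ` (domain c \<inter> f -` domain d)) ?F"
    using f c d by (simp add: smooth_map_def)
  ultimately have F: "(?F has_derivative frechet_derivative ?F (at (coord c (\<gamma> t)))) (at (coord c (\<gamma> t)))"
    by (rule smooth_on_has_derivative[rotated])
  have "(?F \<circ> (coord c \<circ> \<gamma>) has_derivative
      frechet_derivative ?F (at (coord c (\<gamma> t))) \<circ> (\<lambda>h. h *\<^sub>R w)) (at t)"
    using diff_chain_at[of "coord c \<circ> \<gamma>" _ t] w F by (simp add: has_vector_derivative_def)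
  then have "(?F \<circ> (coord c \<circ> \<gamma>) has_vector_derivative frechet_derivative ?F (at (coord c (\<gamma> t))) w) (at t)"
    using linear_cmul[OF has_derivative_linear[OF F]]
    unfolding has_vector_derivative_def by (simp add: o_def)
  then show ?thesis
  proof (rule has_vector_derivative_transform_within_open[OF _ J(1,2)])
    show "(?F \<circ> (coord c \<circ> \<gamma>)) s = (coord d \<circ> (f \<circ> \<gamma>)) s" if "s \<in> J" for s
      using param_coord[OF A c, of "\<gamma> s"] J(3) that by auto
  qed
qed

lemma velocity_smooth_map:
  assumes "differentiable_atlas A" "smooth_map A B f" "c \<in> A"
    "open J" "t \<in> J" "\<gamma> ` J \<subseteq> domain c" "(coord c \<circ> \<gamma> has_vector_derivative w) (at t)"
  shows "velocity B (f \<circ> \<gamma>) t = pushforward B f c (\<gamma> t) w"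
proof -
  have "vector_derivative (coord d \<circ> (f \<circ> \<gamma>)) (at t) =
      frechet_derivative (coord d \<circ> f \<circ> param c) (at (coord c (\<gamma> t))) w"
    if "d \<in> B" "f (\<gamma> t) \<in> domain d" for d
    using smooth_map_curve_has_vector_derivative[OF assms(1-3) that(1) assms(4-6) that(2) assms(7)]
    by (rule vector_derivative_at)
  then show ?thesis by (auto simp: velocity_def pushforward_def fun_eq_iff)
qed

lemma differentiable_curve_in_chart:
  assumes "differentiable_curve A I \<gamma>" "c \<in> A" "t \<in> I" "\<gamma> t \<in> domain c"
  shows "open {s \<in> I. \<gamma> s \<in> domain c}"
    "(coord c \<circ> \<gamma> has_vector_derivative snd (velocity A \<gamma> t) c) (at t)"
  using assms
  by (auto simp: differentiable_curve_def continuous_curve_def velocity_def vector_derivative_works)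

lemma velocity_comp_differentiable_curve:
  assumes "differentiable_atlas A" "smooth_map A B f" "differentiable_curve A I \<gamma>"
    "c \<in> A" "t \<in> I" "\<gamma> t \<in> domain c"
  shows "velocity B (f \<circ> \<gamma>) t = pushforward B f c (\<gamma> t) (snd (velocity A \<gamma> t) c)"
  using differentiable_curve_in_chart[OF assms(3-6)] assms
  by (intro velocity_smooth_map[of A B f c "{s \<in> I. \<gamma> s \<in> domain c}"]) auto

lemma differentiable_curve_comp:
  assumes A: "differentiable_atlas A" and f: "smooth_map A B f" and \<gamma>: "differentiable_curve A I \<gamma>"
  shows "differentiable_curve B I (f \<circ> \<gamma>)"
proof -
  have \<gamma>': "open I" "is_interval I" "\<gamma> ` I \<subseteq> carrier A"
    and chart: "\<And>c. c \<in> A \<Longrightarrow> open {t \<in> I. \<gamma> t \<in> domain c}"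
    "\<And>c. c \<in> A \<Longrightarrow> continuous_on {t \<in> I. \<gamma> t \<in> domain c} (coord c \<circ> \<gamma>)"
    using \<gamma> by (auto simp: differentiable_curve_def continuous_curve_def)
  have diff: "(coord d \<circ> (f \<circ> \<gamma>)) differentiable (at t)"
    if d: "d \<in> B" and t: "t \<in> I" "f (\<gamma> t) \<in> domain d" for d t
  proof -
    obtain c where c: "c \<in> A" "\<gamma> t \<in> domain c" using \<gamma>'(3) t(1) by (auto simp: carrier_def)
    note 1 = differentiable_curve_in_chart[OF \<gamma> c(1) t(1) c(2)]
    from smooth_map_curve_has_vector_derivative[OF A f c(1) d 1(1) _ _ t(2) 1(2)] t c
    show ?thesis by (auto simp: has_vector_derivative_def differentiable_def)
  qed
  have "open {t \<in> I. f (\<gamma> t) \<in> domain d}" if d: "d \<in> B" for d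
  proof -
    let ?S = "\<lambda>c. {t \<in> I. \<gamma> t \<in> domain c} \<inter> (coord c \<circ> \<gamma>) -` (coord c ` (domain c \<inter> f -` domain d))"
    have "open (?S c)" if "c \<in> A" for c
      using continuous_open_preimage[OF chart(2,1)[OF that]] f that d
      by (simp add: smooth_map_def)
    then have "open (\<Union>c\<in>A. ?S c)" by (intro open_UN ballI)
    moreover have "{t \<in> I. f (\<gamma> t) \<in> domain d} = (\<Union>c\<in>A. ?S c)"
    proof (intro equalityI subsetI)
      fix t assume "t \<in> {t \<in> I. f (\<gamma> t) \<in> domain d}"
      moreover from this obtain c where "c \<in> A" "\<gamma> t \<in> domain c"
        using \<gamma>'(3) by (auto simp: carrier_def)
      ultimately show "t \<in> (\<Union>c\<in>A. ?S c)" by auto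
    next
      fix t assume "t \<in> (\<Union>c\<in>A. ?S c)"
      then obtain c p where c: "c \<in> A" "t \<in> I" "\<gamma> t \<in> domain c" "p \<in> domain c" "f p \<in> domain d"
        "coord c (\<gamma> t) = coord c p" by auto
      then have "\<gamma> t = p" using param_coord[OF A c(1)] by metis
      then show "t \<in> {t \<in> I. f (\<gamma> t) \<in> domain d}" using c by simp
    qed
    ultimately show ?thesis by (simp only:)
  qed
  moreover have "continuous_on {t \<in> I. f (\<gamma> t) \<in> domain d} (coord d \<circ> (f \<circ> \<gamma>))" if "d \<in> B" for d
    using diff[OF that]
    by (intro continuous_at_imp_continuous_on ballI differentiable_imp_continuous_within) auto
  moreover have "(f \<circ> \<gamma>) ` I \<subseteq> carrier B" using f \<gamma>'(3) by (auto simp: smooth_map_def)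
  ultimately show ?thesis
    using \<gamma>' diff by (auto simp: differentiable_curve_def continuous_curve_def)
qed

text \<open>A pushed-forward vector is realized by the image of a straight line in the chart.\<close>

lemma pushforward_in_submanifold_tangent_space:
  assumes A: "differentiable_atlas A" and f: "smooth_map A B f" and c: "c \<in> A" "p \<in> domain c"
  shows "pushforward B f c p w \<in> submanifold_tangent_space B (f ` carrier A) (f p)"
proof -
  define l where "l = (\<lambda>t::real. coord c p + t *\<^sub>R w)"
  have l: "continuous_on S l" "(l has_vector_derivative w) (at t)" for S t
    unfolding l_def by (auto intro!: continuous_intros derivative_eq_intros simp: has_vector_derivative_def)
  have "open (l -` (coord c ` domain c))"
    using l(1) open_coord_domain[OF A c(1)] by (metis continuous_on_open_vimage open_UNIV inf_top_right)
  moreover have "0 \<in> l -` (coord c ` domain c)" using c by (simp add: l_def)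
  ultimately obtain e where e: "e > 0" "ball 0 e \<subseteq> l -` (coord c ` domain c)"
    using open_contains_ball by blast
  define I where "I = ball (0::real) e"
  define \<gamma> where "\<gamma> = param c \<circ> l"
  have I: "open I" "0 \<in> I" "is_interval I" and lI: "\<And>t. t \<in> I \<Longrightarrow> l t \<in> coord c ` domain c"
    using e by (auto simp: I_def is_interval_ball_real)
  have \<gamma>: "\<gamma> ` I \<subseteq> domain c" using lI by (auto simp: \<gamma>_def param_in_domain)
  have "(coord c \<circ> \<gamma> has_vector_derivative w) (at 0)"
  proof (rule has_vector_derivative_transform_within_open[OF l(2) I(1,2)])
    show "l t = (coord c \<circ> \<gamma>) t" if "t \<in> I" for t
      using coord_param[OF lI[OF that]] by (simp add: \<gamma>_def)
  qed
  from velocity_smooth_map[OF A f c(1) I(1,2) \<gamma> this]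
  have vel: "velocity B (f \<circ> \<gamma>) 0 = pushforward B f c p w"
    using param_coord[OF A c] by (simp add: \<gamma>_def l_def)
  have S: "open {t \<in> I. f (\<gamma> t) \<in> domain d} \<and>
      smooth_on {t \<in> I. f (\<gamma> t) \<in> domain d} (coord d \<circ> (f \<circ> \<gamma>))" if d: "d \<in> B" for d
  proof
    let ?U = "coord c ` (domain c \<inter> f -` domain d)"
    have U: "open ?U" "smooth_on ?U (coord d \<circ> f \<circ> param c)"
      using f c d by (auto simp: smooth_map_def)
    have eq: "{t \<in> I. f (\<gamma> t) \<in> domain d} = I \<inter> l -` ?U"
    proof (intro equalityI subsetI)
      fix t assume t: "t \<in> {t \<in> I. f (\<gamma> t) \<in> domain d}"
      then have "l t = coord c (\<gamma> t)" using coord_param[OF lI] by (simp add: \<gamma>_def)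
      then show "t \<in> I \<inter> l -` ?U" using t \<gamma> by auto
    next
      fix t assume "t \<in> I \<inter> l -` ?U"
      then show "t \<in> {t \<in> I. f (\<gamma> t) \<in> domain d}"
        using param_in_overlap(2)[OF A c(1), of "l t" "f -` domain d"] by (auto simp: \<gamma>_def)
    qed
    show "open {t \<in> I. f (\<gamma> t) \<in> domain d}"
      unfolding eq using continuous_open_preimage[OF l(1) I(1) U(1)] .
    from smooth_on_line[OF this, of "coord c p" w ?U "coord d \<circ> f \<circ> param c"] U(2)
    show "smooth_on {t \<in> I. f (\<gamma> t) \<in> domain d} (coord d \<circ> (f \<circ> \<gamma>))"
      unfolding eq by (auto simp: l_def \<gamma>_def o_def)
  qed
  have "\<gamma> ` I \<subseteq> carrier A" using \<gamma> c(1) by (auto simp: carrier_def)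
  then have img: "(f \<circ> \<gamma>) ` I \<subseteq> f ` carrier A" by auto
  moreover have "f ` carrier A \<subseteq> carrier B" using f by (simp add: smooth_map_def)
  ultimately have "(f \<circ> \<gamma>) ` I \<subseteq> carrier B" by (rule order_trans)
  moreover have "open {t \<in> I. (f \<circ> \<gamma>) t \<in> domain d}"
      "smooth_on {t \<in> I. (f \<circ> \<gamma>) t \<in> domain d} (coord d \<circ> (f \<circ> \<gamma>))" if "d \<in> B" for d
    using S[OF that] unfolding o_apply by blast+
  ultimately have "smooth_curve B I (f \<circ> \<gamma>)"
    using I(1,3) smooth_on_continuous_on unfolding smooth_curve_def continuous_curve_def by blast
  moreover have "(f \<circ> \<gamma>) 0 = f p" using param_coord[OF A c] by (simp add: \<gamma>_def l_def)
  ultimately have "velocity B (f \<circ> \<gamma>) 0 \<in> submanifold_tangent_space B (f ` carrier A) (f p)"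
    using img I(2) unfolding submanifold_tangent_space_def by blast
  then show ?thesis by (simp only: vel)
qed

section \<open>Integral curves\<close>

lemma vector_field_in_tangent_bundle:
  assumes "vector_field A X" "p \<in> carrier A"
  shows "X p \<in> tangent_bundle A" "fst (X p) = p" "snd (X p) \<in> tangent_space A p"
proof -
  show "X p \<in> tangent_bundle A" "fst (X p) = p"
    using assms unfolding vector_field_def smooth_map_def by (auto simp: carrier_tangent_atlas)
  then show "snd (X p) \<in> tangent_space A p" by (auto simp: tangent_bundle_def)
qed

lemma integral_curve_exists:
  assumes A: "differentiable_atlas A" and X: "vector_field A X" and c: "c \<in> A" "p \<in> domain c"
  obtains I \<gamma> where "integral_curve A X I \<gamma>" "0 \<in> I" "\<gamma> 0 = p"
proof -
  define U where "U = coord c ` domain c"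
  define f where "f = (\<lambda>x. snd ((coord (tangent_chart A c) \<circ> X \<circ> param c) x))"
  have dom: "q \<in> carrier A" if "q \<in> domain d" "d \<in> A" for q d using that by (auto simp: carrier_def)
  have U: "open U" "coord c p \<in> U" using open_coord_domain[OF A c(1)] c(2) by (auto simp: U_def)
  have "domain c \<inter> X -` domain (tangent_chart A c) = domain c"
    using vector_field_in_tangent_bundle[OF X dom[OF _ c(1)]] by (auto simp: domain_tangent_chart)
  then have "smooth_on U (coord (tangent_chart A c) \<circ> X \<circ> param c)"
    using X c(1) tangent_chart_in_atlas[OF c(1)] unfolding vector_field_def smooth_map_def U_def
    by metis
  then have "smooth_on U f"
    using C_k_on_snd[OF U(1)] unfolding smooth_on_def f_def by blast
  then obtain e x where e: "e > 0" "x 0 = coord c p"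
    and x: "\<And>t. t \<in> {-e<..<e} \<Longrightarrow> x t \<in> U \<and> (x has_vector_derivative f (x t)) (at t)"
    using smooth_ode_solution[OF U(1) _ U(2)] by blast
  define I where "I = {-e<..<e}"
  define \<gamma> where "\<gamma> = param c \<circ> x"
  have \<gamma>: "\<gamma> t \<in> domain c" "coord c (\<gamma> t) = x t" "f (x t) = snd (X (\<gamma> t)) c" if "t \<in> I" for t
    using x[of t] that coord_param[of "x t" c] param_in_domain[of "x t" c]
    by (auto simp: \<gamma>_def U_def I_def f_def coord_tangent_chart)
  have cont: "continuous_on I x"
    using x has_vector_derivative_continuous unfolding I_def
    by (intro continuous_at_imp_continuous_on ballI) blast
  have der: "(coord d \<circ> \<gamma> has_vector_derivative snd (X (\<gamma> t)) d) (at t)"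
    if d: "d \<in> A" and t: "t \<in> I" "\<gamma> t \<in> domain d" for d t
  proof -
    let ?T = "frechet_derivative (transition c d) (at (x t))"
    have tr: "(transition c d has_derivative ?T) (at (x t))"
      using transition_has_derivative[OF A c(1) d \<gamma>(1)[OF t(1)] t(2)] \<gamma>(2)[OF t(1)] by simp
    have "(transition c d \<circ> x has_derivative ?T \<circ> (\<lambda>h. h *\<^sub>R f (x t))) (at t)"
      using diff_chain_at[of x _ t, OF _ tr] x[of t] t(1)
      by (simp add: I_def has_vector_derivative_def)
    then have "(transition c d \<circ> x has_vector_derivative ?T (f (x t))) (at t)"
      using linear_cmul[OF has_derivative_linear[OF tr]]
      unfolding has_vector_derivative_def by (simp add: o_def)
    moreover have "?T (f (x t)) = snd (X (\<gamma> t)) d"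
      using tangent_space_transition[OF vector_field_in_tangent_bundle(3)[OF X dom[OF t(2) d]]
          c(1) d \<gamma>(1)[OF t(1)] t(2)] \<gamma>(2,3)[OF t(1)] by simp
    ultimately show ?thesis by (simp add: transition_def \<gamma>_def o_assoc)
  qed
  have "open {t \<in> I. \<gamma> t \<in> domain d}" if d: "d \<in> A" for d
  proof -
    have "{t \<in> I. \<gamma> t \<in> domain d} = I \<inter> x -` (coord c ` (domain c \<inter> domain d))"
    proof (intro equalityI subsetI)
      fix t assume "t \<in> {t \<in> I. \<gamma> t \<in> domain d}"
      then show "t \<in> I \<inter> x -` (coord c ` (domain c \<inter> domain d))"
        using \<gamma>(1,2)[of t] by (auto intro!: image_eqI[of _ _ "\<gamma> t"])
    next
      fix t assume "t \<in> I \<inter> x -` (coord c ` (domain c \<inter> domain d))"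
      then show "t \<in> {t \<in> I. \<gamma> t \<in> domain d}"
        using param_in_overlap(2)[OF A c(1), of "x t" "domain d"] by (auto simp: \<gamma>_def)
    qed
    then show ?thesis
      using continuous_open_preimage[OF cont _ open_overlap[OF A c(1) d]] by (simp add: I_def)
  qed
  moreover have "continuous_on {t \<in> I. \<gamma> t \<in> domain d} (coord d \<circ> \<gamma>)" if d: "d \<in> A" for d
    using der[OF d] has_vector_derivative_continuous
    by (intro continuous_at_imp_continuous_on ballI) blast
  moreover have "\<gamma> ` I \<subseteq> carrier A" using \<gamma>(1) dom[OF _ c(1)] by auto
  moreover have "(coord d \<circ> \<gamma>) differentiable (at t)" if "d \<in> A" "t \<in> I" "\<gamma> t \<in> domain d" for d t
    using der[OF that] unfolding has_vector_derivative_def differentiable_def by blast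
  moreover have "open I" "is_interval I" by (auto simp: I_def is_interval_convex_1)
  ultimately have "differentiable_curve A I \<gamma>"
    unfolding differentiable_curve_def continuous_curve_def by blast
  moreover have "velocity A \<gamma> t = X (\<gamma> t)" if t: "t \<in> I" for t
  proof -
    note Xt = vector_field_in_tangent_bundle[OF X dom[OF \<gamma>(1)[OF t] c(1)]]
    have "snd (velocity A \<gamma> t) d = snd (X (\<gamma> t)) d" for d
    proof (cases "d \<in> A \<and> \<gamma> t \<in> domain d")
      case True
      then show ?thesis using der t by (simp add: velocity_def vector_derivative_at)
    next
      case False
      then have "snd (X (\<gamma> t)) d = 0" using Xt(3) unfolding tangent_space_def by blast
      then show ?thesis using False by (auto simp: velocity_def)
    qed
    then show ?thesis using Xt(2) by (intro prod_eqI) (auto simp: velocity_def)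
  qed
  ultimately have "integral_curve A X I \<gamma>" by (simp add: integral_curve_def)
  moreover have "0 \<in> I" "\<gamma> 0 = p" using e param_coord[OF A c] by (auto simp: I_def \<gamma>_def)
  ultimately show thesis using that by blast
qed

section \<open>The Lagrangian vector field is a second order differential equation\<close>

lemma theta_in_chart:
  assumes Q: "smooth_atlas Q" and L: "smooth_function (tangent_atlas Q) L"
    and c: "c \<in> Q" "fst u \<in> domain c" and u: "u \<in> tangent_bundle Q"
    and \<xi>: "\<xi> \<in> tangent_space (tangent_atlas Q) u"
  defines "C \<equiv> tangent_chart Q c"
  shows "theta Q L u \<xi> = frechet_derivative (L \<circ> param C) (at (coord C u)) (0, fst (\<xi> C))"
proof -
  define d where "d = chart_at Q (fst u)"
  define D where "D = tangent_chart Q d"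
  note TQ = differentiable_atlas_tangent_atlas[OF Q]
  have "fst u \<in> carrier Q" using u by (auto simp: tangent_bundle_def)
  then have d: "d \<in> Q" "fst u \<in> domain d" unfolding d_def by (rule chart_at)+
  have CD: "C \<in> tangent_atlas Q" "D \<in> tangent_atlas Q" "u \<in> domain C" "u \<in> domain D"
    using c d u by (auto simp: C_def D_def tangent_chart_in_atlas domain_tangent_chart)
  let ?T = "frechet_derivative (transition C D) (at (coord C u))"
  let ?G = "frechet_derivative (L \<circ> param D) (at (coord D u))"
  note T = frechet_derivative_transition_tangent_chart[OF Q c(1) d(1) u c(2) d(2), folded C_def D_def]
  have diff: "(L \<circ> param D) differentiable (at (coord D u))"
    using L CD(2,4) smooth_on_differentiable unfolding smooth_function_def by blast
  then have lin: "linear ?G" using frechet_derivative_works has_derivative_linear by blast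
  let ?a = "fst (\<xi> D)"
  have "theta Q L u \<xi> = (\<Sum>b\<in>Basis. ?G (0, b) * (?a \<bullet> b))"
    by (simp add: theta_def Let_def d_def D_def)
  also have "\<dots> = (\<Sum>b\<in>Basis. ?G ((?a \<bullet> b) *\<^sub>R (0, b)))"
    by (simp only: linear_cmul[OF lin] real_scaleR_def mult.commute)
  also have "\<dots> = ?G (\<Sum>b\<in>Basis. (?a \<bullet> b) *\<^sub>R (0, b))"
    by (simp only: linear_sum[OF lin])
  also have "(\<Sum>b\<in>Basis. (?a \<bullet> b) *\<^sub>R (0, b)) = (0, ?a)"
    by (simp add: prod_eq_iff fst_sum snd_sum euclidean_representation)
  also have "?a = fst (?T (\<xi> C))"
    by (rule arg_cong[OF tangent_space_transition[OF \<xi> CD]])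
  also have "?G (0, fst (?T (\<xi> C))) = ?G (?T (0, fst (\<xi> C)))"
    by (simp only: T)
  also have "\<dots> = frechet_derivative (L \<circ> param C) (at (coord C u)) (0, fst (\<xi> C))"
    using frechet_derivative_change_chart[OF TQ CD diff] by simp
  finally show ?thesis .
qed

lemma energy_in_chart:
  assumes Q: "smooth_atlas Q" and L: "smooth_function (tangent_atlas Q) L"
    and c: "c \<in> Q" "fst u \<in> domain c" and u: "u \<in> tangent_bundle Q"
  defines "C \<equiv> tangent_chart Q c"
  shows "energy Q L u = frechet_derivative (L \<circ> param C) (at (coord C u)) (0, snd u c) - L u"
proof -
  define d where "d = chart_at Q (fst u)"
  define D where "D = tangent_chart Q d"
  note TQ = differentiable_atlas_tangent_atlas[OF Q]
  have u': "fst u \<in> carrier Q" "snd u \<in> tangent_space Q (fst u)"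
    using u by (auto simp: tangent_bundle_def)
  then have d: "d \<in> Q" "fst u \<in> domain d" unfolding d_def by (auto intro: chart_at)
  have CD: "C \<in> tangent_atlas Q" "D \<in> tangent_atlas Q" "u \<in> domain C" "u \<in> domain D"
    using c d u by (auto simp: C_def D_def tangent_chart_in_atlas domain_tangent_chart)
  define \<xi> where "\<xi> = tangent_of (tangent_atlas Q) D u (0, snd u d)"
  have \<xi>: "\<xi> \<in> tangent_space (tangent_atlas Q) u"
    unfolding \<xi>_def by (rule tangent_of_in_tangent_space[OF TQ CD(2,4)])
  have "\<xi> C = frechet_derivative (transition D C) (at (coord D u)) (0, snd u d)"
    using CD(1,3) by (simp add: \<xi>_def tangent_of_def)
  also have "\<dots> = (0, frechet_derivative (transition d c) (at (coord d (fst u))) (snd u d))"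
    using frechet_derivative_transition_tangent_chart(2)[OF Q d(1) c(1) u d(2) c(2)]
    by (simp add: C_def D_def)
  also have "\<dots> = (0, snd u c)"
    using tangent_space_transition[OF u'(2) d(1) c(1) d(2) c(2)] by simp
  finally have \<xi>C: "\<xi> C = (0, snd u c)" .
  have "(L \<circ> param E) differentiable (at (coord E u))" if "E \<in> tangent_atlas Q" "u \<in> domain E" for E
    using L that smooth_on_differentiable unfolding smooth_function_def by blast
  from differential_in_chart[OF TQ CD(1,3) \<xi> this]
  have "differential (tangent_atlas Q) L u \<xi> =
      frechet_derivative (L \<circ> param C) (at (coord C u)) (0, snd u c)"
    by (simp add: \<xi>C)
  then show ?thesis
    by (simp add: energy_def liouville_def Let_def \<xi>_def d_def D_def)
qed

text \<open>Contracting the equation \<open>i(\<Gamma>) \<omega>\<^sub>L = dE\<^sub>L\<close> with vertical vectors gives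
  \<open>\<partial>\<^sup>2L/\<partial>v\<^sup>i\<partial>v\<^sup>j (\<Gamma>\<^sup>i - v\<^sup>i) = 0\<close>, and nondegeneracy of \<open>\<omega>\<^sub>L\<close> on vertical vectors makes the Hessian
  invertible. The Hessian \<open>M\<close> appears with its two arguments in different roles; instead of its
  symmetry the proof uses that a linear endomorphism is injective iff it is surjective.\<close>

lemma lagrangian_vector_field_second_order:
  fixes Q :: "('a, 'e::euclidean_space) chart set"
  assumes Q: "smooth_atlas Q" and L: "smooth_function (tangent_atlas Q) L"
    and reg: "regular_lagrangian Q L" and \<Gamma>: "lagrangian_vector_field Q L \<Gamma>"
    and u: "u \<in> tangent_bundle Q"
  obtains c where "c \<in> Q" "fst u \<in> domain c" "fst (snd (\<Gamma> u) (tangent_chart Q c)) = snd u c"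
proof -
  let ?TQ = "tangent_atlas Q"
  note TQ = differentiable_atlas_tangent_atlas[OF Q]
  define C where "C = chart_at ?TQ u"
  have "u \<in> carrier ?TQ" using u by (simp add: carrier_tangent_atlas)
  then have C: "C \<in> ?TQ" "u \<in> domain C" unfolding C_def by (rule chart_at)+
  then obtain c where c: "c \<in> Q" "C = tangent_chart Q c" by (auto simp: tangent_atlas_def)
  have uc: "fst u \<in> domain c" using C(2) c(2) by (simp add: domain_tangent_chart)
  define z0 where "z0 = coord C u"
  define v where "v = snd u c"
  have z0: "snd z0 = v" by (simp add: z0_def v_def c coord_tangent_chart)
  define W where "W = coord C ` domain C"
  have W: "open W" "z0 \<in> W" using open_coord_domain[OF TQ C(1)] C(2) by (auto simp: W_def z0_def)
  have param_W: "param C z \<in> domain C" "coord C (param C z) = z" "param C z \<in> tangent_bundle Q"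
      "fst (param C z) \<in> domain c" "snd (param C z) c = snd z" if "z \<in> W" for z
  proof -
    show 1: "param C z \<in> domain C" and 2: "coord C (param C z) = z"
      using that by (auto simp: W_def coord_param param_in_domain)
    show "param C z \<in> tangent_bundle Q" "fst (param C z) \<in> domain c"
      using 1 by (auto simp: c(2) domain_tangent_chart)
    show "snd (param C z) c = snd z"
      using arg_cong[OF 2, of snd] by (simp add: c(2) coord_tangent_chart)
  qed

  define l where "l = L \<circ> param C"
  define G where "G = (\<lambda>z. frechet_derivative l (at z))"
  have l_smooth: "smooth_on W l" using L C(1) by (auto simp: smooth_function_def l_def W_def)
  have l_der: "(l has_derivative G z) (at z)" if "z \<in> W" for z
    using smooth_on_has_derivative[OF l_smooth that] by (simp add: G_def)
  have G_sum: "G z (0, a) = (\<Sum>b\<in>Basis. (a \<bullet> b) * G z (0, b))" if "z \<in> W" for z a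
  proof -
    have lin: "linear (G z)" using l_der[OF that] has_derivative_linear by blast
    have "(0, a) = (\<Sum>b\<in>Basis. (a \<bullet> b) *\<^sub>R (0, b))"
      by (simp add: prod_eq_iff fst_sum snd_sum euclidean_representation)
    then have "G z (0, a) = G z (\<Sum>b\<in>Basis. (a \<bullet> b) *\<^sub>R (0, b))" by (rule arg_cong)
    also have "\<dots> = (\<Sum>b\<in>Basis. (a \<bullet> b) * G z (0, b))"
      by (simp only: linear_sum[OF lin] linear_cmul[OF lin] real_scaleR_def)
    finally show ?thesis .
  qed
  define M where "M = (\<lambda>a. frechet_derivative (\<lambda>z. G z (0, a)) (at z0))"
  have M_der: "((\<lambda>z. G z (0, a)) has_derivative M a) (at z0)" for a
    using smooth_on_has_derivative[OF smooth_on_frechet_derivative[OF l_smooth] W(2)]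
    by (simp add: G_def M_def)
  have M_lin: "linear (M a)" for a using M_der has_derivative_linear by blast
  have "((\<lambda>z. \<Sum>b\<in>Basis. (a \<bullet> b) * G z (0, b)) has_derivative (\<lambda>h. \<Sum>b\<in>Basis. (a \<bullet> b) * M b h)) (at z0)" for a
    by (intro has_derivative_sum has_derivative_mult_right M_der)
  then have "((\<lambda>z. G z (0, a)) has_derivative (\<lambda>h. \<Sum>b\<in>Basis. (a \<bullet> b) * M b h)) (at z0)" for a
    by (rule has_derivative_transform_within_open[OF _ W]) (simp add: G_sum)
  then have M_sum: "M a h = (\<Sum>b\<in>Basis. (a \<bullet> b) * M b h)" for a h
    using fun_cong[OF has_derivative_unique[OF M_der]] by blast

  have omega: "omega Q L u \<xi> \<eta> = M (fst (\<xi> C)) (\<eta> C) - M (fst (\<eta> C)) (\<xi> C)" for \<xi> \<eta>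
  proof -
    define comp where "comp = (\<lambda>h x. theta Q L (param C x) (tangent_of ?TQ C (param C x) h))"
    have "comp h z = G z (0, fst h)" if z: "z \<in> W" for h z
      using theta_in_chart[OF Q L c(1) param_W(4)[OF z] param_W(3)[OF z]
          tangent_of_in_tangent_space[OF TQ C(1) param_W(1)[OF z]], folded c(2)]
        tangent_of_self[OF TQ C(1) param_W(1)[OF z]] param_W(2)[OF z]
      by (simp add: comp_def G_def l_def)
    then have "frechet_derivative (comp h) (at z0) = M (fst h)" for h
      unfolding M_def by (rule frechet_derivative_cong_open[OF W])
    then show ?thesis
      by (simp add: omega_def ext_deriv_1form_def Let_def comp_def z0_def flip: C_def)
  qed

  have dE: "differential ?TQ (energy Q L) u \<eta> = M v (\<eta> C) + G z0 (0, snd (\<eta> C)) - G z0 (\<eta> C)" for \<eta>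
  proof -
    have "((\<lambda>z. (\<Sum>b\<in>Basis. (snd z \<bullet> b) * G z (0, b)) - l z) has_derivative
        (\<lambda>h. (\<Sum>b\<in>Basis. (snd z0 \<bullet> b) * M b h + (snd h \<bullet> b) * G z0 (0, b)) - G z0 h)) (at z0)"
      by (intro has_derivative_diff has_derivative_sum has_derivative_mult M_der l_der W
          has_derivative_inner_left has_derivative_snd has_derivative_ident)
    moreover have "(\<lambda>h. (\<Sum>b\<in>Basis. (snd z0 \<bullet> b) * M b h + (snd h \<bullet> b) * G z0 (0, b)) - G z0 h) =
        (\<lambda>h. M v h + G z0 (0, snd h) - G z0 h)"
    proof
      fix h
      show "(\<Sum>b\<in>Basis. (snd z0 \<bullet> b) * M b h + (snd h \<bullet> b) * G z0 (0, b)) - G z0 h =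
          M v h + G z0 (0, snd h) - G z0 h"
        unfolding M_sum[of v h] G_sum[OF W(2), of "snd h"] sum.distrib z0 by (rule refl)
    qed
    ultimately have "((\<lambda>z. (\<Sum>b\<in>Basis. (snd z \<bullet> b) * G z (0, b)) - l z) has_derivative
        (\<lambda>h. M v h + G z0 (0, snd h) - G z0 h)) (at z0)" by (rule subst[rotated])
    then have "(energy Q L \<circ> param C has_derivative (\<lambda>h. M v h + G z0 (0, snd h) - G z0 h)) (at z0)"
    proof (rule has_derivative_transform_within_open[OF _ W])
      show "(\<Sum>b\<in>Basis. (snd z \<bullet> b) * G z (0, b)) - l z = (energy Q L \<circ> param C) z" if z: "z \<in> W" for z
        using energy_in_chart[OF Q L c(1) param_W(4)[OF z] param_W(3)[OF z], folded c(2)] param_W(2)[OF z] param_W(5)[OF z]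
          G_sum[OF z, of "snd z"]
        by (simp add: G_def l_def)
    qed
    then show ?thesis
      by (simp add: differential_def Let_def frechet_derivative_eq z0_def flip: C_def)
  qed

  let ?vert = "\<lambda>b. tangent_of ?TQ C u (0, b)"
  have vert: "?vert b \<in> tangent_space ?TQ u" "?vert b C = (0, b)" for b
    using tangent_of_in_tangent_space[OF TQ C] tangent_of_self[OF TQ C] by auto
  have M0: "M 0 h = 0" for h using M_sum[of 0 h] by simp
  define a where "a = fst (snd (\<Gamma> u) C)"
  have "M a (0, b) = M v (0, b)" for b
  proof -
    have "omega Q L u (snd (\<Gamma> u)) (?vert b) = differential ?TQ (energy Q L) u (?vert b)"
      using \<Gamma> u vert(1) by (simp add: lagrangian_vector_field_def)
    then show ?thesis by (simp add: omega dE vert(2) M0 a_def)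
  qed
  then have M_diff: "M (a - v) (0, b) = 0" for b
    using M_sum[of a] M_sum[of v] M_sum[of "a - v"]
    by (simp add: inner_diff_left left_diff_distrib sum_subtractf)

  define T where "T = (\<lambda>w. \<Sum>b\<in>Basis. M b (0, w) *\<^sub>R b)"
  have "linear T"
  proof (rule linearI)
    show "T (x + y) = T x + T y" for x y
      using linear_add[OF M_lin, of _ "(0, x)" "(0, y)"]
      by (simp add: T_def scaleR_add_left sum.distrib)
    show "T (r *\<^sub>R x) = r *\<^sub>R T x" for r x
      using linear_cmul[OF M_lin, of _ r "(0, x)"]
      by (simp add: T_def scaleR_sum_right)
  qed
  moreover have "w = 0" if "T w = 0" for w
  proof -
    have "M b (0, w) = 0" if "b \<in> Basis" for b
    proof -
      have "M b (0, w) = T w \<bullet> b"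
        using that by (simp add: T_def inner_sum_left inner_Basis if_distrib cong: if_cong)
      then show ?thesis by (simp add: \<open>T w = 0\<close>)
    qed
    then have "M h (0, w) = 0" for h using M_sum[of h "(0, w)"] by simp
    then have "\<forall>\<eta>\<in>tangent_space ?TQ u. omega Q L u (?vert w) \<eta> = 0"
      by (simp add: omega vert(2) M0)
    then have "?vert w = (\<lambda>_. 0)"
      using reg \<open>u \<in> carrier ?TQ\<close> vert(1) unfolding regular_lagrangian_def symplectic_def by blast
    then show "w = 0" using vert(2)[of w] by (simp add: prod_eq_iff)
  qed
  ultimately have "surj T"
    using linear_injective_0 linear_injective_imp_surjective by blast
  then obtain w where w: "a - v = T w" by blast
  have "(a - v) \<bullet> (a - v) = (\<Sum>b\<in>Basis. ((a - v) \<bullet> b) * M b (0, w))"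
    by (subst (2) w) (simp add: T_def inner_sum_right mult.commute)
  also have "\<dots> = M (a - v) (0, w)" by (rule M_sum[symmetric])
  also have "\<dots> = 0" by (rule M_diff)
  finally have "a = v" by simp
  then show thesis using that[OF c(1) uc] by (simp add: a_def v_def c(2))
qed

section \<open>The Hamilton--Jacobi problem\<close>

lemma invariant_imp_pushforward:
  fixes Q :: "('a, 'e::euclidean_space) chart set"
  assumes Q: "smooth_atlas Q" and L: "smooth_function (tangent_atlas Q) L"
    and reg: "regular_lagrangian Q L" and \<Gamma>: "lagrangian_vector_field Q L \<Gamma>"
    and X: "vector_field Q X"
    and inv: "invariant_submanifold (tangent_atlas Q) \<Gamma> (X ` carrier Q)"
    and p: "p \<in> carrier Q"
  obtains c where "c \<in> Q" "p \<in> domain c" "\<Gamma> (X p) = pushforward (tangent_atlas Q) X c p (snd (X p) c)"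
proof -
  note diff = smooth_atlas_imp_differentiable_atlas[OF Q]
  have Xp: "fst (X p) = p" if "p \<in> carrier Q" for p by (rule vector_field_in_tangent_bundle[OF X that])
  obtain c where c: "c \<in> Q" "p \<in> domain c" "fst (snd (\<Gamma> (X p)) (tangent_chart Q c)) = snd (X p) c"
    using lagrangian_vector_field_second_order[OF Q L reg \<Gamma> vector_field_in_tangent_bundle(1)[OF X p]]
      Xp[OF p] by metis
  let ?C = "tangent_chart Q c"
  have C: "?C \<in> tangent_atlas Q" using c(1) by (rule tangent_chart_in_atlas)
  have "\<Gamma> (X p) \<in> submanifold_tangent_space (tangent_atlas Q) (X ` carrier Q) (X p)"
    using inv p by (simp add: invariant_submanifold_def)
  then obtain \<sigma> I where \<sigma>: "\<Gamma> (X p) = velocity (tangent_atlas Q) \<sigma> 0" "smooth_curve (tangent_atlas Q) I \<sigma>"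
      "0 \<in> I" "\<sigma> 0 = X p" "\<sigma> ` I \<subseteq> X ` carrier Q"
    unfolding submanifold_tangent_space_def by blast
  define \<rho> where "\<rho> = fst \<circ> \<sigma>"
  have \<rho>: "\<rho> t \<in> carrier Q \<and> \<sigma> t = X (\<rho> t)" if "t \<in> I" for t
    using \<sigma>(5) that Xp by (auto simp: \<rho>_def)
  define J where "J = {t \<in> I. \<sigma> t \<in> domain ?C}"
  have I: "open I" and J: "open J" and smooth: "smooth_on J (coord ?C \<circ> \<sigma>)"
    using \<sigma>(2) C by (auto simp: smooth_curve_def continuous_curve_def J_def)
  have dom: "X q \<in> domain ?C \<longleftrightarrow> q \<in> domain c" if "q \<in> carrier Q" for q
    using vector_field_in_tangent_bundle[OF X that] by (simp add: domain_tangent_chart)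
  have "0 \<in> J" using \<sigma>(3,4) c(2) dom[OF p] by (simp add: J_def)
  have "\<rho> ` J \<subseteq> domain c" using \<rho> dom by (auto simp: J_def)
  have "(coord ?C \<circ> \<sigma> has_vector_derivative snd (\<Gamma> (X p)) ?C) (at 0)"
  proof -
    have "(coord ?C \<circ> \<sigma>) differentiable (at 0)"
      by (rule smooth_on_differentiable[OF smooth \<open>0 \<in> J\<close>])
    then show ?thesis using C \<open>0 \<in> J\<close> \<sigma>(1)
      by (simp add: J_def velocity_def vector_derivative_works)
  qed
  from has_derivative_fst[OF this[unfolded has_vector_derivative_def]]
  have "(coord c \<circ> \<rho> has_vector_derivative snd (X p) c) (at 0)"
    by (simp add: has_vector_derivative_def c(3) coord_tangent_chart \<rho>_def o_def)
  from velocity_smooth_map[OF diff _ c(1) J \<open>0 \<in> J\<close> \<open>\<rho> ` J \<subseteq> domain c\<close> this, of "tangent_atlas Q" X] X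
  have "velocity (tangent_atlas Q) (X \<circ> \<rho>) 0 = pushforward (tangent_atlas Q) X c p (snd (X p) c)"
    using Xp[OF p] \<sigma>(4) by (simp add: vector_field_def \<rho>_def)
  moreover have "velocity (tangent_atlas Q) (X \<circ> \<rho>) 0 = velocity (tangent_atlas Q) \<sigma> 0"
  proof -
    have "(coord D \<circ> (X \<circ> \<rho>) has_vector_derivative w) (at 0) \<longleftrightarrow>
        (coord D \<circ> \<sigma> has_vector_derivative w) (at 0)" for D and w :: "'e \<times> 'e"
      using has_vector_derivative_transform_within_open[OF _ I \<sigma>(3), of "coord D \<circ> (X \<circ> \<rho>)" w "coord D \<circ> \<sigma>"]
        has_vector_derivative_transform_within_open[OF _ I \<sigma>(3), of "coord D \<circ> \<sigma>" w "coord D \<circ> (X \<circ> \<rho>)"]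
        \<rho> by auto
    then have eq: "vector_derivative (coord D \<circ> (X \<circ> \<rho>)) (at 0) = vector_derivative (coord D \<circ> \<sigma>) (at 0)"
      for D :: "(('a, 'e) tvec, 'e \<times> 'e) chart"
      by (simp add: vector_derivative_def)
    have "X (\<rho> 0) = \<sigma> 0" using \<rho>[OF \<sigma>(3)] by simp
    then show ?thesis by (simp only: velocity_def eq o_apply)
  qed
  ultimately show thesis using that[OF c(1,2)] \<sigma>(1) by simp
qed

theorem proposition2:
  fixes Q :: "('a, 'e::euclidean_space) chart set"
    and L :: "('a, 'e) tvec \<Rightarrow> real"
    and \<Gamma> :: "('a, 'e) tvec \<Rightarrow> (('a, 'e) tvec, 'e \<times> 'e) tvec"
    and X :: "'a \<Rightarrow> ('a, 'e) tvec"
  assumes "smooth_manifold Q"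
    and "smooth_function (tangent_atlas Q) L"
    and "regular_lagrangian Q L"
    and "lagrangian_vector_field Q L \<Gamma>"
    and "vector_field Q X"
  shows "HJ_solution Q \<Gamma> X \<longleftrightarrow> invariant_submanifold (tangent_atlas Q) \<Gamma> (X ` carrier Q)"
proof
  have Q: "smooth_atlas Q" using assms(1) by (simp add: smooth_manifold_def)
  note diff = smooth_atlas_imp_differentiable_atlas[OF Q]
  have X: "smooth_map Q (tangent_atlas Q) X" using assms(5) by (simp add: vector_field_def)
  have velocity_X: "velocity (tangent_atlas Q) (X \<circ> \<gamma>) t =
      pushforward (tangent_atlas Q) X c (\<gamma> t) (snd (X (\<gamma> t)) c)"
    if "integral_curve Q X I \<gamma>" "c \<in> Q" "t \<in> I" "\<gamma> t \<in> domain c" for I \<gamma> c t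
  proof -
    have "differentiable_curve Q I \<gamma>" "velocity Q \<gamma> t = X (\<gamma> t)"
      using that(1,3) unfolding integral_curve_def by blast+
    then show ?thesis using velocity_comp_differentiable_curve[OF diff X, of I \<gamma> c t] that(2-4) by simp
  qed
  {
    assume HJ: "HJ_solution Q \<Gamma> X"
    show "invariant_submanifold (tangent_atlas Q) \<Gamma> (X ` carrier Q)"
      unfolding invariant_submanifold_def
    proof
      fix u assume "u \<in> X ` carrier Q"
      then obtain p c where p: "u = X p" "c \<in> Q" "p \<in> domain c" by (auto simp: carrier_def)
      obtain I \<gamma> where \<gamma>: "integral_curve Q X I \<gamma>" "0 \<in> I" "\<gamma> 0 = p"
        using integral_curve_exists[OF diff assms(5) p(2,3)] .
      then have "integral_curve (tangent_atlas Q) \<Gamma> I (X \<circ> \<gamma>)" using HJ by (simp add: HJ_solution_def)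
      then have "\<Gamma> (X p) = velocity (tangent_atlas Q) (X \<circ> \<gamma>) 0"
        using \<gamma>(2,3) by (simp add: integral_curve_def)
      also have "\<dots> = pushforward (tangent_atlas Q) X c p (snd (X p) c)"
        using velocity_X[OF \<gamma>(1) p(2) \<gamma>(2)] \<gamma>(3) p(3) by simp
      finally show "\<Gamma> u \<in> submanifold_tangent_space (tangent_atlas Q) (X ` carrier Q) u"
        using pushforward_in_submanifold_tangent_space[OF diff X p(2,3)] p(1) by simp
    qed
  next
    assume inv: "invariant_submanifold (tangent_atlas Q) \<Gamma> (X ` carrier Q)"
    show "HJ_solution Q \<Gamma> X"
      unfolding HJ_solution_def
    proof (intro allI impI)
      fix I \<gamma> assume \<gamma>: "integral_curve Q X I \<gamma>"
      have "velocity (tangent_atlas Q) (X \<circ> \<gamma>) t = \<Gamma> ((X \<circ> \<gamma>) t)" if t: "t \<in> I" for t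
      proof -
        have "\<gamma> t \<in> carrier Q"
          using \<gamma> t by (auto simp: integral_curve_def differentiable_curve_def continuous_curve_def)
        from invariant_imp_pushforward[OF Q assms(2-5) inv this]
        obtain c where "c \<in> Q" "\<gamma> t \<in> domain c"
          "\<Gamma> (X (\<gamma> t)) = pushforward (tangent_atlas Q) X c (\<gamma> t) (snd (X (\<gamma> t)) c)" .
        then show ?thesis using velocity_X[OF \<gamma> _ t] by simp
      qed
      then show "integral_curve (tangent_atlas Q) \<Gamma> I (X \<circ> \<gamma>)"
        using differentiable_curve_comp[OF diff X] \<gamma> by (simp add: integral_curve_def)
    qed
  }
qed

end
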